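(* Let $\mathcal I$ be a small direct category and $\Sigma$ an $\mathcal I$-sorted signature of some dimension $\alpha$. The functor $\mathrm{Und}_\Sigma:\mathrm{Alg}_\Sigma\to\mathrm{Comp}^{\mathrm{var}}_\Sigma$ is right adjoint to the free algebra functor $\mathrm{Free}_\Sigma:\mathrm{Comp}^{\mathrm{var}}_\Sigma\to\mathrm{Alg}_\Sigma$.
   Context: **Conventions.** $\mathcal I$ is a small direct category: a small category with a function $\dim:\mathrm{ob}\,\mathcal I\to\mathrm{Ord}$ such that $\dim j<\dim i$ whenever there is a non-identity morphism $j\to i$. Its objects are called sorts and its morphisms face maps. For a presheaf $X$ we write $X_i$ for its value at $i$ and $\delta^*:X_i\to X_j$ for the action of $\delta:j\to i$. $\mathcal I_\beta$ is the full subcategory of sorts of dimension $\le\beta$, and $\mathrm{tr}_\beta$ denotes restriction of presheaves to $\mathcal I_\beta$. **Signatures, computads, terms.** The following are defined simultaneously by transfinite recursion on an ordinal $\alpha$: the class of ($\mathcal I$-sorted) signatures $\Sigma$ of dimension $\alpha$, with restrictions $\Sigma_\beta$ of dimension $\beta$ for $\beta\le\alpha$; for each such $\Sigma$ a category $\mathrm{Comp}_\Sigma$ of $\Sigma$-computads with truncation functors $\mathrm{tr}^\Sigma_\beta:\mathrm{Comp}_\Sigma\to\mathrm{Comp}_{\Sigma_\beta}$, written $C\mapsto C_\beta$, $\sigma\mapsto\sigma_\beta$; and an adjunction $\mathrm{Cptd}_\Sigma\dashv\mathrm{Term}_\Sigma$ with $\mathrm{Cptd}_\Sigma:[\mathcal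 I_\alpha^{\mathrm{op}},\mathrm{Set}]\to\mathrm{Comp}_\Sigma$, unit $\eta_\Sigma$, counit $\varepsilon_\Sigma$, inducing the monad $\mathrm M_\Sigma=\mathrm{Term}_\Sigma\mathrm{Cptd}_\Sigma$ with unit $\eta_\Sigma$ and multiplication $\mu_\Sigma$. All of these commute strictly with truncation, and truncations satisfy the cocycle conditions ($\mathrm{tr}_\gamma\mathrm{tr}_\beta=\mathrm{tr}_\gamma$ for $\gamma\le\beta\le\alpha$, and $\mathrm{tr}_\alpha=\mathrm{id}$). An extra subscript $j$ denotes evaluation of a presheaf at the sort $j$. Given the data for all ordinals below $\alpha$: (1) A signature $\Sigma$ of dimension $\alpha$ is a compatible family of signatures $\Sigma_\beta$ ($\beta<\alpha$, $(\Sigma_\beta)_\gamma=\Sigma_\gamma$) and, for each sort $i$ with $\dim i=\alpha$, a set $\Sigma_i$ of function symbols; each $f\in\Sigma_i$ has an arity $B_f$, a presheaf on $\mathcal I_\alpha$, and for each non-identity $\delta:j\to i$, with $\beta=\dim j$, a boundary term $t_{f,\delta}\in\mathrm M_{\Sigma_\beta,j}(\mathrm{tr}_\beta B_f)$, such that $(\delta')^*t_{f,\delta}=t_{f,\delta\delta'}$ for every $\delta':k\to j$. (2) A $\Sigma$-computad $C$ is a compatible family of $\Sigma_\beta$-computads $C_\beta$ ($\beta<\alpha$) and, for each sort $i$ with $\dim i=\alpha$, a set $V_i^C$ of generators with gluing functions $\phi^C_\delta:V_i^C\to\mathrm{Term}_{\Sigma_\beta,j}(C_\beta)$ for non-identity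 $\delta:j\to i$, $\beta=\dim j$, such that $(\delta')^*\phi^C_\delta=\phi^C_{\delta\delta'}$. (3) For $\dim j=\beta<\alpha$, $\mathrm{Term}_{\Sigma,j}(C)=\mathrm{Term}_{\Sigma_\beta,j}(C_\beta)$. For $\dim i=\alpha$, the set $\mathrm{Term}_{\Sigma,i}(C)$ is inductively generated by terms $\mathrm{var}\,v$ for $v\in V_i^C$ and $f[\tau]$ for $f\in\Sigma_i$ and $\tau:\mathrm{Cptd}_\Sigma B_f\to C$ a morphism of computads. For non-identity $\delta:j\to i$, $\beta=\dim j$: $\delta^*(\mathrm{var}\,v)=\phi^C_\delta(v)$ and $\delta^*(f[\tau])=\mathrm{Term}_{\Sigma_\beta,j}(\tau_\beta)(t_{f,\delta})$. (4) A morphism $\sigma:C\to D$ is a compatible family of morphisms $\sigma_\beta:C_\beta\to D_\beta$ ($\beta<\alpha$) and functions $\sigma_i:V_i^C\to\mathrm{Term}_{\Sigma,i}(D)$ for $\dim i=\alpha$ with $\delta^*\sigma_i=\mathrm{Term}_{\Sigma_\beta,j}(\sigma_\beta)\circ\phi^C_\delta$ for non-identity $\delta:j\to i$, $\beta=\dim j$. In dimension $\alpha$, $\mathrm{Term}_\Sigma(\sigma)(\mathrm{var}\,v)=\sigma_i(v)$ and $\mathrm{Term}_\Sigma(\sigma)(f[\tau])=f[\sigma\circ\tau]$; in lower dimension $\mathrm{Term}_\Sigma(\sigma)$ is $\mathrm{Term}_{\Sigma_\beta}(\sigma_\beta)$. Composition: $(\tau\sigma)_\beta=\tau_\beta\sigma_\beta$,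 $(\tau\sigma)_i=\mathrm{Term}_{\Sigma,i}(\tau)\circ\sigma_i$; identities are given by $\mathrm{id}_{C_\beta}$ and $\mathrm{var}$. (5) $\mathrm{Cptd}_\Sigma X$ consists of $\mathrm{Cptd}_{\Sigma_\beta}\mathrm{tr}_\beta X$ ($\beta<\alpha$), generators $X_i$ ($\dim i=\alpha$) and gluing functions $\phi_\delta=\eta_{\Sigma_\beta,\mathrm{tr}_\beta X,j}\circ\delta^*:X_i\to\mathrm M_{\Sigma_\beta,j}(\mathrm{tr}_\beta X)$; on morphisms $(\mathrm{Cptd}_\Sigma\sigma)_i=\mathrm{var}\circ\sigma_i$. (6) $\eta_\Sigma(x)=\mathrm{var}\,x$ for $x$ of sort of dimension $\alpha$ (and $\eta_{\Sigma_\beta}$ below); $\varepsilon_{\Sigma,C}:\mathrm{Cptd}_\Sigma\mathrm{Term}_\Sigma C\to C$ consists of the $\varepsilon_{\Sigma_\beta,C_\beta}$ and the identity functions of $\mathrm{Term}_{\Sigma,i}(C)$. (Items (3),(4) are a valid inductive-recursive definition.) For a sort $i$ of dimension $\beta<\alpha$, the notations $\Sigma_i,V_i^C,\phi^C_\delta,\sigma_i$ refer to $\Sigma_\beta,C_\beta,\sigma_\beta$. **Variable-to-variable morphisms.** A morphism $\sigma:C\to D$ is variable-to-variable if $\sigma_i(v)$ is a generator (of the form $\mathrm{var}\,w$) for every sort $i$ of dimension $\le\alpha$ and $v\in V_i^C$. Computads and variable-to-variable morphisms form a subcategory $\zeta_\Sigma:\mathrm{Comp}^{\mathrm{var}}_\Sigma\hookrightarrow\mathrm{Comp}_\Sigma$.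 **Algebras.** A $\Sigma$-algebra $\mathbb X=(X,u^{\mathbb X})$ is an (Eilenberg–Moore) algebra for the monad $(\mathrm M_\Sigma,\eta_\Sigma,\mu_\Sigma)$ on $[\mathcal I_\alpha^{\mathrm{op}},\mathrm{Set}]$; $\mathrm{Alg}_\Sigma$ is their category. Its truncation is the $\Sigma_\beta$-algebra $\mathrm{tr}^\Sigma_\beta\mathbb X=(\mathrm{tr}_\beta X,\mathrm{tr}_\beta u^{\mathbb X})$. The comparison functor $\mathrm K_\Sigma:\mathrm{Comp}_\Sigma\to\mathrm{Alg}_\Sigma$ sends $C$ to $\mathrm{Term}_\Sigma C$ with action $\mathrm{Term}_\Sigma(\varepsilon_{\Sigma,C})$, and $\sigma$ to $\mathrm{Term}_\Sigma(\sigma)$. Put $\mathrm{Free}_\Sigma=\mathrm K_\Sigma\zeta_\Sigma$. **The functor $\mathrm{Und}_\Sigma$.** It is defined by recursion on $\alpha$, simultaneously with a natural transformation $r_\Sigma:\mathrm{Cof}_\Sigma:=\mathrm{Free}_\Sigma\mathrm{Und}_\Sigma\Rightarrow\mathrm{id}$, all compatible with truncation. $\mathrm{Und}_\Sigma\mathbb X$ consists of the computads $\mathrm{Und}_{\Sigma_\beta}\mathrm{tr}^\Sigma_\beta\mathbb X$ ($\beta<\alpha$) and, for $\dim i=\alpha$, the set $V_i^{\mathrm{Und}_\Sigma\mathbb X}$ of pairs $((t_\delta)_\delta,x)$ where $x\in X_i$ and $(t_\delta)$ is a family, indexed by the non-identity face maps $\delta:j\to i$, of elements $t_\delta\in(\mathrm{Cof}_{\Sigma_\beta}\mathrm{tr}^\Sigma_\beta\mathbb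 X)_j$ ($\beta=\dim j$) with $(\delta')^*t_\delta=t_{\delta\delta'}$ and $r_{\Sigma_\beta}(t_\delta)=\delta^*x$; the gluing functions are $\phi_\delta((t_\delta),x)=t_\delta$. For $\sigma:\mathbb X\to\mathbb Y$, $\mathrm{Und}_\Sigma\sigma$ consists of the $\mathrm{Und}_{\Sigma_\beta}\mathrm{tr}^\Sigma_\beta\sigma$ and the functions $((t_\delta),x)\mapsto((\mathrm{Cof}_{\Sigma_\beta}(\mathrm{tr}^\Sigma_\beta\sigma)(t_\delta)),\sigma(x))$. The component $r_{\Sigma,\mathbb X}:\mathrm{Cof}_\Sigma\mathbb X\to\mathbb X$ is the unique morphism of algebras with $\mathrm{tr}^\Sigma_\beta r_{\Sigma,\mathbb X}=r_{\Sigma_\beta,\mathrm{tr}^\Sigma_\beta\mathbb X}$ for $\beta<\alpha$ and $r_{\Sigma,\mathbb X}(\mathrm{var}((t_\delta),x))=x$ for generators of sorts of dimension $\alpha$. *)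

theory Defs
  imports Main
begin

text \<open>
  Conventions.  Ordinals are the elements of an arbitrary well-ordered type \<open>'o\<close>; sets of sorts,
  face maps, function symbols, arity elements, generators and algebra elements are sets over
  arbitrary types.  A structure of dimension \<open>\<alpha>\<close> (presheaf on the sorts of dimension at most \<open>\<alpha>\<close>,
  signature, computad) is a family indexed by all sorts which is empty outside the sorts of dimension
  at most \<open>\<alpha>\<close>.  Truncation to \<open>\<beta>\<close> empties the part above \<open>\<beta>\<close>, and a compatible family of
  truncations is stored as its union; the lemmas \<open>is_term_tr\<close>, \<open>is_signature_rec\<close> and
  \<open>is_computad_rec\<close> below recover the transfinite recursion.  Functions on carriers are
  \<open>undefined\<close> outside their domain, so that equality of morphisms is equality in HOL.

  \<open>Free\<close> and \<open>Und\<close> change the type over which generators and carriers are taken, so morphisms are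
  defined between structures over possibly different types, and statements about categories of
  structures range over all these types.
\<close>

subsection \<open>Direct categories and presheaves\<close>

record ('i, 'm, 'o) dcat =
  ob  :: "'i set"
  arr :: "'m set"
  src :: "'m \<Rightarrow> 'i"
  tgt :: "'m \<Rightarrow> 'i"
  idm :: "'i \<Rightarrow> 'm"
  cmp :: "'m \<Rightarrow> 'm \<Rightarrow> 'm"
  dim :: "'i \<Rightarrow> 'o"

definition proper :: "('i, 'm, 'o) dcat \<Rightarrow> 'm \<Rightarrow> bool" where
  "proper I \<delta> \<longleftrightarrow> \<delta> \<in> arr I \<and> \<delta> \<notin> idm I ` ob I"

definition direct_category :: "('i, 'm, 'o::wellorder) dcat \<Rightarrow> bool" where
  "direct_category I \<longleftrightarrow>
     (\<forall>\<delta>\<in>arr I. src I \<delta> \<in> ob I \<and> tgt I \<delta> \<in> ob I) \<and>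
     (\<forall>i\<in>ob I. idm I i \<in> arr I \<and> src I (idm I i) = i \<and> tgt I (idm I i) = i) \<and>
     (\<forall>\<delta>\<in>arr I. \<forall>\<delta>'\<in>arr I. tgt I \<delta>' = src I \<delta> \<longrightarrow>
        cmp I \<delta> \<delta>' \<in> arr I \<and> src I (cmp I \<delta> \<delta>') = src I \<delta>' \<and> tgt I (cmp I \<delta> \<delta>') = tgt I \<delta>) \<and>
     (\<forall>\<delta>\<in>arr I. cmp I \<delta> (idm I (src I \<delta>)) = \<delta> \<and> cmp I (idm I (tgt I \<delta>)) \<delta> = \<delta>) \<and>
     (\<forall>\<delta>\<in>arr I. \<forall>\<delta>'\<in>arr I. \<forall>\<delta>''\<in>arr I. tgt I \<delta>' = src I \<delta> \<longrightarrow> tgt I \<delta>'' = src I \<delta>' \<longrightarrow>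
        cmp I (cmp I \<delta> \<delta>') \<delta>'' = cmp I \<delta> (cmp I \<delta>' \<delta>'')) \<and>
     (\<forall>\<delta>. proper I \<delta> \<longrightarrow> dim I (src I \<delta>) < dim I (tgt I \<delta>))"

definition restr :: "('i \<Rightarrow> 'a set) \<Rightarrow> ('i \<Rightarrow> 'a \<Rightarrow> 'b) \<Rightarrow> 'i \<Rightarrow> 'a \<Rightarrow> 'b" where
  "restr S h = (\<lambda>i x. if x \<in> S i then h i x else undefined)"

record ('i, 'm, 'a) psh =
  El  :: "'i \<Rightarrow> 'a set"
  act :: "'m \<Rightarrow> 'a \<Rightarrow> 'a"

definition presheaf :: "('i, 'm, 'o::wellorder) dcat \<Rightarrow> 'o \<Rightarrow> ('i, 'm, 'a) psh \<Rightarrow> bool" where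
  "presheaf I \<alpha> X \<longleftrightarrow>
     (\<forall>i. El X i \<noteq> {} \<longrightarrow> i \<in> ob I \<and> dim I i \<le> \<alpha>) \<and>
     (\<forall>\<delta>\<in>arr I. \<forall>x\<in>El X (tgt I \<delta>). act X \<delta> x \<in> El X (src I \<delta>)) \<and>
     (\<forall>i\<in>ob I. \<forall>x\<in>El X i. act X (idm I i) x = x) \<and>
     (\<forall>\<delta>\<in>arr I. \<forall>\<delta>'\<in>arr I. tgt I \<delta>' = src I \<delta> \<longrightarrow>
        (\<forall>x\<in>El X (tgt I \<delta>). act X (cmp I \<delta> \<delta>') x = act X \<delta>' (act X \<delta> x)))"

definition psh_hom ::
  "('i, 'm, 'o) dcat \<Rightarrow> ('i, 'm, 'a) psh \<Rightarrow> ('i, 'm, 'b) psh \<Rightarrow> ('i \<Rightarrow> 'a \<Rightarrow> 'b) set" where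
  "psh_hom I X Y = {h.
     restr (El X) h = h \<and>
     (\<forall>i. \<forall>x\<in>El X i. h i x \<in> El Y i) \<and>
     (\<forall>\<delta>\<in>arr I. \<forall>x\<in>El X (tgt I \<delta>). act Y \<delta> (h (tgt I \<delta>) x) = h (src I \<delta>) (act X \<delta> x))}"

definition psh_id :: "('i, 'm, 'a) psh \<Rightarrow> 'i \<Rightarrow> 'a \<Rightarrow> 'a" where
  "psh_id X = restr (El X) (\<lambda>i x. x)"

definition psh_comp ::
  "('i, 'm, 'a) psh \<Rightarrow> ('i \<Rightarrow> 'b \<Rightarrow> 'c) \<Rightarrow> ('i \<Rightarrow> 'a \<Rightarrow> 'b) \<Rightarrow> 'i \<Rightarrow> 'a \<Rightarrow> 'c" where
  "psh_comp X k h = restr (El X) (\<lambda>i x. k i (h i x))"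

definition psh_tr ::
  "('i, 'm, 'o::wellorder) dcat \<Rightarrow> 'o \<Rightarrow> ('i, 'm, 'a) psh \<Rightarrow> ('i, 'm, 'a) psh" where
  "psh_tr I \<beta> X = X\<lparr>El := \<lambda>i. if dim I i \<le> \<beta> then El X i else {}\<rparr>"


subsection \<open>Signatures, computads and terms\<close>

text \<open>
  In \<open>App i f \<tau>\<close>, the sort \<open>i\<close> is that of \<open>f\<close>, and \<open>\<tau>\<close> is a morphism out of the computad generated
  by the arity of \<open>f\<close>, given by its functions on generators.  These expressions are raw;
  the terms of a computad are singled out by \<open>is_term\<close>.
\<close>

datatype ('i, 'f, 'x, 'v) tm =
    Var 'i 'v
  | App 'i 'f "'i \<Rightarrow> 'x \<Rightarrow> ('i, 'f, 'x, 'v) tm"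

record ('i, 'm, 'f, 'x) sig =
  Sym   :: "'i \<Rightarrow> 'f set"
  arity :: "'i \<Rightarrow> 'f \<Rightarrow> ('i, 'm, 'x) psh"
  bdry  :: "'f \<Rightarrow> 'm \<Rightarrow> ('i, 'f, 'x, 'x) tm"

record ('i, 'm, 'f, 'x, 'v) cptd =
  Gen  :: "'i \<Rightarrow> 'v set"
  glue :: "'m \<Rightarrow> 'v \<Rightarrow> ('i, 'f, 'x, 'v) tm"

definition sig_tr ::
  "('i, 'm, 'o::wellorder) dcat \<Rightarrow> 'o \<Rightarrow> ('i, 'm, 'f, 'x) sig \<Rightarrow> ('i, 'm, 'f, 'x) sig" where
  "sig_tr I \<beta> \<Sigma> = \<Sigma>\<lparr>Sym := \<lambda>i. if dim I i \<le> \<beta> then Sym \<Sigma> i else {}\<rparr>"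

definition cptd_tr ::
  "('i, 'm, 'o::wellorder) dcat \<Rightarrow> 'o \<Rightarrow> ('i, 'm, 'f, 'x, 'v) cptd \<Rightarrow> ('i, 'm, 'f, 'x, 'v) cptd" where
  "cptd_tr I \<beta> C = C\<lparr>Gen := \<lambda>i. if dim I i \<le> \<beta> then Gen C i else {}\<rparr>"

text \<open>\<open>subst \<Sigma> \<sigma>\<close> is \<open>Term(\<sigma>)\<close> on raw terms; the restriction in the second clause is the one in the
  composite \<open>\<sigma> \<circ> \<tau>\<close> of morphisms of computads.\<close>

primrec subst ::
  "('i, 'm, 'f, 'x) sig \<Rightarrow> ('i \<Rightarrow> 'v \<Rightarrow> ('i, 'f, 'x, 'w) tm) \<Rightarrow> ('i, 'f, 'x, 'v) tm \<Rightarrow> ('i, 'f, 'x, 'w) tm"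
  where
  "subst \<Sigma> \<sigma> (Var i v) = \<sigma> i v"
| "subst \<Sigma> \<sigma> (App i f \<tau>) = App i f (restr (El (arity \<Sigma> i f)) (\<lambda>j x. subst \<Sigma> \<sigma> (\<tau> j x)))"

text \<open>\<open>bd I \<Sigma> C \<delta>\<close> is the action \<open>\<delta>\<^sup>*\<close> on the terms of \<open>C\<close>.\<close>

definition bd ::
  "('i, 'm, 'o) dcat \<Rightarrow> ('i, 'm, 'f, 'x) sig \<Rightarrow> ('i, 'm, 'f, 'x, 'v) cptd \<Rightarrow>
   'm \<Rightarrow> ('i, 'f, 'x, 'v) tm \<Rightarrow> ('i, 'f, 'x, 'v) tm" where
  "bd I \<Sigma> C \<delta> t =
     (if \<delta> \<in> idm I ` ob I then t
      else case t of Var i v \<Rightarrow> glue C \<delta> v | App i f \<tau> \<Rightarrow> subst \<Sigma> \<tau> (bdry \<Sigma> f \<delta>))"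

definition eta :: "'i \<Rightarrow> 'a \<Rightarrow> ('i, 'f, 'x, 'a) tm" where
  "eta i x = Var i x"

definition Cptd :: "('i, 'm, 'o) dcat \<Rightarrow> ('i, 'm, 'a) psh \<Rightarrow> ('i, 'm, 'f, 'x, 'a) cptd" where
  "Cptd I X = \<lparr>Gen = El X, glue = (\<lambda>\<delta> x. eta (src I \<delta>) (act X \<delta> x))\<rparr>"

text \<open>The conditions on a morphism \<open>\<sigma> : C \<rightarrow> D\<close>, with the family \<open>T\<close> in place of the terms of \<open>D\<close>
  so that it can be used in the inductive definition of terms.\<close>

definition cptd_mor ::
  "('i, 'm, 'o) dcat \<Rightarrow> ('i, 'm, 'f, 'x) sig \<Rightarrow> ('i \<Rightarrow> ('i, 'f, 'x, 'w) tm \<Rightarrow> bool) \<Rightarrow>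
   ('i, 'm, 'f, 'x, 'v) cptd \<Rightarrow> ('i, 'm, 'f, 'x, 'w) cptd \<Rightarrow> ('i \<Rightarrow> 'v \<Rightarrow> ('i, 'f, 'x, 'w) tm) \<Rightarrow> bool"
  where
  "cptd_mor I \<Sigma> T C D \<sigma> \<longleftrightarrow>
     restr (Gen C) \<sigma> = \<sigma> \<and>
     (\<forall>i. \<forall>v\<in>Gen C i. T i (\<sigma> i v)) \<and>
     (\<forall>\<delta>. proper I \<delta> \<longrightarrow> (\<forall>v\<in>Gen C (tgt I \<delta>).
        bd I \<Sigma> D \<delta> (\<sigma> (tgt I \<delta>) v) = subst \<Sigma> \<sigma> (glue C \<delta> v)))"

lemma cptd_mor_mono [mono]:
  "(\<And>i t. T i t \<longrightarrow> T' i t) \<Longrightarrow> cptd_mor I \<Sigma> T C D \<sigma> \<longrightarrow> cptd_mor I \<Sigma> T' C D \<sigma>"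
  unfolding cptd_mor_def by blast

inductive is_term ::
  "('i, 'm, 'o) dcat \<Rightarrow> ('i, 'm, 'f, 'x) sig \<Rightarrow> ('i, 'm, 'f, 'x, 'v) cptd \<Rightarrow>
   'i \<Rightarrow> ('i, 'f, 'x, 'v) tm \<Rightarrow> bool"
  for I \<Sigma> C where
  var: "v \<in> Gen C i \<Longrightarrow> is_term I \<Sigma> C i (Var i v)"
| app: "f \<in> Sym \<Sigma> i \<Longrightarrow> cptd_mor I \<Sigma> (is_term I \<Sigma> C) (Cptd I (arity \<Sigma> i f)) C \<tau> \<Longrightarrow>
        is_term I \<Sigma> C i (App i f \<tau>)"

text \<open>The parts of a signature and of a computad at a single sort, which need only the data below it.\<close>

definition sig_at ::
  "('i, 'm, 'o::wellorder) dcat \<Rightarrow> ('i, 'm, 'f, 'x) sig \<Rightarrow> 'i \<Rightarrow> bool" where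
  "sig_at I \<Sigma> i \<longleftrightarrow> (\<forall>f\<in>Sym \<Sigma> i.
     presheaf I (dim I i) (arity \<Sigma> i f) \<and>
     (\<forall>\<delta>. proper I \<delta> \<longrightarrow> tgt I \<delta> = i \<longrightarrow>
        (let j = src I \<delta>; \<beta> = dim I j; \<Sigma>\<^sub>\<beta> = sig_tr I \<beta> \<Sigma>; B\<^sub>\<beta> = psh_tr I \<beta> (arity \<Sigma> i f) in
         is_term I \<Sigma>\<^sub>\<beta> (Cptd I B\<^sub>\<beta>) j (bdry \<Sigma> f \<delta>) \<and>
         (\<forall>\<delta>'\<in>arr I. tgt I \<delta>' = j \<longrightarrow>
            bd I \<Sigma>\<^sub>\<beta> (Cptd I B\<^sub>\<beta>) \<delta>' (bdry \<Sigma> f \<delta>) = bdry \<Sigma> f (cmp I \<delta> \<delta>')))))"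

definition is_signature ::
  "('i, 'm, 'o::wellorder) dcat \<Rightarrow> 'o \<Rightarrow> ('i, 'm, 'f, 'x) sig \<Rightarrow> bool" where
  "is_signature I \<alpha> \<Sigma> \<longleftrightarrow>
     (\<forall>i. Sym \<Sigma> i \<noteq> {} \<longrightarrow> i \<in> ob I \<and> dim I i \<le> \<alpha>) \<and> (\<forall>i\<in>ob I. sig_at I \<Sigma> i)"

definition cptd_at ::
  "('i, 'm, 'o::wellorder) dcat \<Rightarrow> ('i, 'm, 'f, 'x) sig \<Rightarrow> ('i, 'm, 'f, 'x, 'v) cptd \<Rightarrow> 'i \<Rightarrow> bool" where
  "cptd_at I \<Sigma> C i \<longleftrightarrow> (\<forall>v\<in>Gen C i.
     \<forall>\<delta>. proper I \<delta> \<longrightarrow> tgt I \<delta> = i \<longrightarrow>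
        (let j = src I \<delta>; \<beta> = dim I j; \<Sigma>\<^sub>\<beta> = sig_tr I \<beta> \<Sigma>; C\<^sub>\<beta> = cptd_tr I \<beta> C in
         is_term I \<Sigma>\<^sub>\<beta> C\<^sub>\<beta> j (glue C \<delta> v) \<and>
         (\<forall>\<delta>'\<in>arr I. tgt I \<delta>' = j \<longrightarrow>
            bd I \<Sigma>\<^sub>\<beta> C\<^sub>\<beta> \<delta>' (glue C \<delta> v) = glue C (cmp I \<delta> \<delta>') v)))"

definition is_computad ::
  "('i, 'm, 'o::wellorder) dcat \<Rightarrow> 'o \<Rightarrow> ('i, 'm, 'f, 'x) sig \<Rightarrow> ('i, 'm, 'f, 'x, 'v) cptd \<Rightarrow> bool" where
  "is_computad I \<alpha> \<Sigma> C \<longleftrightarrow>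
     (\<forall>i. Gen C i \<noteq> {} \<longrightarrow> i \<in> ob I \<and> dim I i \<le> \<alpha>) \<and> (\<forall>i\<in>ob I. cptd_at I \<Sigma> C i)"

definition comp_hom ::
  "('i, 'm, 'o) dcat \<Rightarrow> ('i, 'm, 'f, 'x) sig \<Rightarrow> ('i, 'm, 'f, 'x, 'v) cptd \<Rightarrow> ('i, 'm, 'f, 'x, 'w) cptd \<Rightarrow>
   ('i \<Rightarrow> 'v \<Rightarrow> ('i, 'f, 'x, 'w) tm) set" where
  "comp_hom I \<Sigma> C D = {\<sigma>. cptd_mor I \<Sigma> (is_term I \<Sigma> D) C D \<sigma>}"

definition comp_id :: "('i, 'm, 'f, 'x, 'v) cptd \<Rightarrow> 'i \<Rightarrow> 'v \<Rightarrow> ('i, 'f, 'x, 'v) tm" where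
  "comp_id C = restr (Gen C) Var"

definition comp_comp ::
  "('i, 'm, 'f, 'x) sig \<Rightarrow> ('i, 'm, 'f, 'x, 'v) cptd \<Rightarrow> ('i \<Rightarrow> 'w \<Rightarrow> ('i, 'f, 'x, 'z) tm) \<Rightarrow>
   ('i \<Rightarrow> 'v \<Rightarrow> ('i, 'f, 'x, 'w) tm) \<Rightarrow> 'i \<Rightarrow> 'v \<Rightarrow> ('i, 'f, 'x, 'z) tm" where
  "comp_comp \<Sigma> C \<tau> \<sigma> = restr (Gen C) (\<lambda>i v. subst \<Sigma> \<tau> (\<sigma> i v))"

definition var_hom ::
  "('i, 'm, 'o) dcat \<Rightarrow> ('i, 'm, 'f, 'x) sig \<Rightarrow> ('i, 'm, 'f, 'x, 'v) cptd \<Rightarrow> ('i, 'm, 'f, 'x, 'w) cptd \<Rightarrow>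
   ('i \<Rightarrow> 'v \<Rightarrow> ('i, 'f, 'x, 'w) tm) set" where
  "var_hom I \<Sigma> C D =
     {\<sigma> \<in> comp_hom I \<Sigma> C D. \<forall>i. \<forall>v\<in>Gen C i. \<exists>w\<in>Gen D i. \<sigma> i v = Var i w}"

definition Term ::
  "('i, 'm, 'o) dcat \<Rightarrow> ('i, 'm, 'f, 'x) sig \<Rightarrow> ('i, 'm, 'f, 'x, 'v) cptd \<Rightarrow>
   ('i, 'm, ('i, 'f, 'x, 'v) tm) psh" where
  "Term I \<Sigma> C = \<lparr>El = (\<lambda>i. {t. is_term I \<Sigma> C i t}), act = bd I \<Sigma> C\<rparr>"

definition Term_map ::
  "('i, 'm, 'o) dcat \<Rightarrow> ('i, 'm, 'f, 'x) sig \<Rightarrow> ('i, 'm, 'f, 'x, 'v) cptd \<Rightarrow>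
   ('i \<Rightarrow> 'v \<Rightarrow> ('i, 'f, 'x, 'w) tm) \<Rightarrow> 'i \<Rightarrow> ('i, 'f, 'x, 'v) tm \<Rightarrow> ('i, 'f, 'x, 'w) tm" where
  "Term_map I \<Sigma> C \<sigma> = restr (El (Term I \<Sigma> C)) (\<lambda>i. subst \<Sigma> \<sigma>)"


subsection \<open>Agreement with the recursion on dimension\<close>

lemma tm_induct [case_names Var App]:
  assumes "\<And>i v. P (Var i v)" and "\<And>i f \<tau>. (\<And>j x. P (\<tau> j x)) \<Longrightarrow> P (App i f \<tau>)"
  shows "P t"
proof (induction t)
  case (Var i v)
  show ?case by (rule assms(1))
next
  case (App i f \<tau>)
  show ?case by (rule assms(2), rule App[OF rangeI rangeI])
qed

lemma sig_tr_simps [simp]: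
  "Sym (sig_tr I \<beta> \<Sigma>) i = (if dim I i \<le> \<beta> then Sym \<Sigma> i else {})"
  "arity (sig_tr I \<beta> \<Sigma>) = arity \<Sigma>" "bdry (sig_tr I \<beta> \<Sigma>) = bdry \<Sigma>"
  by (simp_all add: sig_tr_def)

lemma cptd_tr_simps [simp]:
  "Gen (cptd_tr I \<beta> C) i = (if dim I i \<le> \<beta> then Gen C i else {})" "glue (cptd_tr I \<beta> C) = glue C"
  by (simp_all add: cptd_tr_def)

lemma subst_tr [simp]: "subst (sig_tr I \<beta> \<Sigma>) \<sigma> t = subst \<Sigma> \<sigma> t"
  by (induction t rule: tm_induct) simp_all

lemma bd_tr [simp]:
  "bd I (sig_tr I \<beta> \<Sigma>) = bd I \<Sigma>" "bd I \<Sigma> (cptd_tr I \<beta> C) = bd I \<Sigma> C"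
  by (simp_all add: bd_def fun_eq_iff split: tm.split)

lemma sig_tr_sig_tr: "\<gamma> \<le> \<beta> \<Longrightarrow> sig_tr I \<gamma> (sig_tr I \<beta> \<Sigma>) = sig_tr I \<gamma> \<Sigma>"
  by (rule sig.equality) (auto simp: fun_eq_iff)

lemma cptd_tr_cptd_tr: "\<gamma> \<le> \<beta> \<Longrightarrow> cptd_tr I \<gamma> (cptd_tr I \<beta> C) = cptd_tr I \<gamma> C"
  by (rule cptd.equality) (auto simp: fun_eq_iff)

lemma is_term_tr:
  assumes "is_signature I \<alpha> \<Sigma>" and "dim I j \<le> \<beta>"
  shows "is_term I (sig_tr I \<beta> \<Sigma>) (cptd_tr I \<beta> C) j t \<longleftrightarrow> is_term I \<Sigma> C j t"
proof
  show "is_term I \<Sigma> C j t" if "is_term I (sig_tr I \<beta> \<Sigma>) (cptd_tr I \<beta> C) j t"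
    using that
  proof (induction rule: is_term.induct)
    case (var v i)
    then show ?case
      by (auto split: if_splits intro: is_term.var)
  next
    case (app f i \<tau>)
    then show ?case
      by (intro is_term.app) (auto simp: cptd_mor_def split: if_splits)
  qed
  show "is_term I (sig_tr I \<beta> \<Sigma>) (cptd_tr I \<beta> C) j t" if "is_term I \<Sigma> C j t"
    using that assms(2)
  proof (induction rule: is_term.induct)
    case (var v i)
    then show ?case
      by (auto intro: is_term.var)
  next
    case (app f i \<tau>)
    have "dim I k \<le> \<beta>" if "x \<in> El (arity \<Sigma> i f) k" for k x
      using assms(1) app that
      by (fastforce simp: is_signature_def sig_at_def presheaf_def)
    with app show ?case
      by (intro is_term.app) (auto simp: cptd_mor_def Cptd_def)
  qed
qed

lemma sig_at_tr:
  assumes "direct_category I" and "dim I i \<le> \<beta>"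
  shows "sig_at I (sig_tr I \<beta> \<Sigma>) i \<longleftrightarrow> sig_at I \<Sigma> i"
proof -
  have "sig_tr I (dim I (src I \<delta>)) (sig_tr I \<beta> \<Sigma>) = sig_tr I (dim I (src I \<delta>)) \<Sigma>"
    if "proper I \<delta>" "tgt I \<delta> = i" for \<delta>
    using that assms by (intro sig_tr_sig_tr) (force simp: direct_category_def)
  with assms(2) show ?thesis
    by (simp add: sig_at_def Let_def)
qed

lemma is_signature_rec:
  assumes "direct_category I"
  shows "is_signature I \<alpha> \<Sigma> \<longleftrightarrow>
    (\<forall>i. Sym \<Sigma> i \<noteq> {} \<longrightarrow> i \<in> ob I \<and> dim I i \<le> \<alpha>) \<and>
    (\<forall>\<beta><\<alpha>. is_signature I \<beta> (sig_tr I \<beta> \<Sigma>)) \<and>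
    (\<forall>i\<in>ob I. dim I i = \<alpha> \<longrightarrow> sig_at I \<Sigma> i)" (is "?L \<longleftrightarrow> ?R")
proof
  assume ?L
  moreover have "sig_at I (sig_tr I \<beta> \<Sigma>) i" if "i \<in> ob I" for \<beta> i
  proof (cases "dim I i \<le> \<beta>")
    case True
    then show ?thesis
      using \<open>?L\<close> that by (simp add: is_signature_def sig_at_tr[OF assms])
  qed (simp add: sig_at_def)
  ultimately show ?R
    by (simp add: is_signature_def)
next
  assume ?R
  have "sig_at I \<Sigma> i" if "i \<in> ob I" for i
  proof (cases "dim I i" \<alpha> rule: linorder_cases)
    case less
    with \<open>?R\<close> have "is_signature I (dim I i) (sig_tr I (dim I i) \<Sigma>)"
      by blast
    with that have "sig_at I (sig_tr I (dim I i) \<Sigma>) i"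
      by (simp add: is_signature_def)
    then show ?thesis
      by (simp add: sig_at_tr[OF assms order.refl])
  next
    case equal
    then show ?thesis
      using \<open>?R\<close> that by blast
  next
    case greater
    then have "Sym \<Sigma> i = {}"
      using \<open>?R\<close>[THEN conjunct1, rule_format, of i] by (cases "Sym \<Sigma> i = {}") auto
    then show ?thesis
      by (simp add: sig_at_def)
  qed
  with \<open>?R\<close> show ?L
    by (simp add: is_signature_def)
qed

lemma cptd_at_tr:
  assumes "direct_category I" and "dim I i \<le> \<beta>"
  shows "cptd_at I (sig_tr I \<beta> \<Sigma>) (cptd_tr I \<beta> C) i \<longleftrightarrow> cptd_at I \<Sigma> C i"
proof -
  have "sig_tr I (dim I (src I \<delta>)) (sig_tr I \<beta> \<Sigma>) = sig_tr I (dim I (src I \<delta>)) \<Sigma>"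
       "cptd_tr I (dim I (src I \<delta>)) (cptd_tr I \<beta> C) = cptd_tr I (dim I (src I \<delta>)) C"
    if "proper I \<delta>" "tgt I \<delta> = i" for \<delta>
    using that assms by (intro sig_tr_sig_tr cptd_tr_cptd_tr; force simp: direct_category_def)+
  with assms(2) show ?thesis
    by (simp add: cptd_at_def Let_def)
qed

lemma is_computad_rec:
  assumes "direct_category I"
  shows "is_computad I \<alpha> \<Sigma> C \<longleftrightarrow>
    (\<forall>i. Gen C i \<noteq> {} \<longrightarrow> i \<in> ob I \<and> dim I i \<le> \<alpha>) \<and>
    (\<forall>\<beta><\<alpha>. is_computad I \<beta> (sig_tr I \<beta> \<Sigma>) (cptd_tr I \<beta> C)) \<and>
    (\<forall>i\<in>ob I. dim I i = \<alpha> \<longrightarrow> cptd_at I \<Sigma> C i)" (is "?L \<longleftrightarrow> ?R")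
proof
  assume ?L
  moreover have "cptd_at I (sig_tr I \<beta> \<Sigma>) (cptd_tr I \<beta> C) i" if "i \<in> ob I" for \<beta> i
  proof (cases "dim I i \<le> \<beta>")
    case True
    then show ?thesis
      using \<open>?L\<close> that by (simp add: is_computad_def cptd_at_tr[OF assms])
  qed (simp add: cptd_at_def)
  ultimately show ?R
    by (simp add: is_computad_def)
next
  assume ?R
  have "cptd_at I \<Sigma> C i" if "i \<in> ob I" for i
  proof (cases "dim I i" \<alpha> rule: linorder_cases)
    case less
    with \<open>?R\<close> have "is_computad I (dim I i) (sig_tr I (dim I i) \<Sigma>) (cptd_tr I (dim I i) C)"
      by blast
    with that have "cptd_at I (sig_tr I (dim I i) \<Sigma>) (cptd_tr I (dim I i) C) i"
      by (simp add: is_computad_def)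
    then show ?thesis
      by (simp add: cptd_at_tr[OF assms order.refl])
  next
    case equal
    then show ?thesis
      using \<open>?R\<close> that by blast
  next
    case greater
    then have "Gen C i = {}"
      using \<open>?R\<close>[THEN conjunct1, rule_format, of i] by (cases "Gen C i = {}") auto
    then show ?thesis
      by (simp add: cptd_at_def)
  qed
  with \<open>?R\<close> show ?L
    by (simp add: is_computad_def)
qed


subsection \<open>Algebras\<close>

definition Cptd_map ::
  "('i, 'm, 'a) psh \<Rightarrow> ('i \<Rightarrow> 'a \<Rightarrow> 'b) \<Rightarrow> 'i \<Rightarrow> 'a \<Rightarrow> ('i, 'f, 'x, 'b) tm" where
  "Cptd_map X h = restr (El X) (\<lambda>i x. Var i (h i x))"

definition eps ::
  "('i, 'm, 'o) dcat \<Rightarrow> ('i, 'm, 'f, 'x) sig \<Rightarrow> ('i, 'm, 'f, 'x, 'v) cptd \<Rightarrow>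
   'i \<Rightarrow> ('i, 'f, 'x, 'v) tm \<Rightarrow> ('i, 'f, 'x, 'v) tm" where
  "eps I \<Sigma> C = restr (El (Term I \<Sigma> C)) (\<lambda>i t. t)"

definition Mnd ::
  "('i, 'm, 'o) dcat \<Rightarrow> ('i, 'm, 'f, 'x) sig \<Rightarrow> ('i, 'm, 'a) psh \<Rightarrow>
   ('i, 'm, ('i, 'f, 'x, 'a) tm) psh" where
  "Mnd I \<Sigma> X = Term I \<Sigma> (Cptd I X)"

definition Mnd_map ::
  "('i, 'm, 'o) dcat \<Rightarrow> ('i, 'm, 'f, 'x) sig \<Rightarrow> ('i, 'm, 'a) psh \<Rightarrow> ('i \<Rightarrow> 'a \<Rightarrow> 'b) \<Rightarrow>
   'i \<Rightarrow> ('i, 'f, 'x, 'a) tm \<Rightarrow> ('i, 'f, 'x, 'b) tm" where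
  "Mnd_map I \<Sigma> X h = Term_map I \<Sigma> (Cptd I X) (Cptd_map X h)"

definition mu ::
  "('i, 'm, 'o) dcat \<Rightarrow> ('i, 'm, 'f, 'x) sig \<Rightarrow> ('i, 'm, 'a) psh \<Rightarrow>
   'i \<Rightarrow> ('i, 'f, 'x, ('i, 'f, 'x, 'a) tm) tm \<Rightarrow> ('i, 'f, 'x, 'a) tm" where
  "mu I \<Sigma> X = Term_map I \<Sigma> (Cptd I (Mnd I \<Sigma> X)) (eps I \<Sigma> (Cptd I X))"

record ('i, 'm, 'f, 'x, 'a) alg =
  car :: "('i, 'm, 'a) psh"
  str :: "'i \<Rightarrow> ('i, 'f, 'x, 'a) tm \<Rightarrow> 'a"

definition is_algebra ::
  "('i, 'm, 'o::wellorder) dcat \<Rightarrow> 'o \<Rightarrow> ('i, 'm, 'f, 'x) sig \<Rightarrow> ('i, 'm, 'f, 'x, 'a) alg \<Rightarrow> bool" where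
  "is_algebra I \<alpha> \<Sigma> \<X> \<longleftrightarrow>
     presheaf I \<alpha> (car \<X>) \<and>
     str \<X> \<in> psh_hom I (Mnd I \<Sigma> (car \<X>)) (car \<X>) \<and>
     (\<forall>i. \<forall>x\<in>El (car \<X>) i. str \<X> i (eta i x) = x) \<and>
     (\<forall>i. \<forall>t\<in>El (Mnd I \<Sigma> (Mnd I \<Sigma> (car \<X>))) i.
        str \<X> i (Mnd_map I \<Sigma> (Mnd I \<Sigma> (car \<X>)) (str \<X>) i t) = str \<X> i (mu I \<Sigma> (car \<X>) i t))"

definition alg_hom ::
  "('i, 'm, 'o) dcat \<Rightarrow> ('i, 'm, 'f, 'x) sig \<Rightarrow> ('i, 'm, 'f, 'x, 'a) alg \<Rightarrow>
   ('i, 'm, 'f, 'x, 'b) alg \<Rightarrow> ('i \<Rightarrow> 'a \<Rightarrow> 'b) set" where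
  "alg_hom I \<Sigma> \<X> \<Y> = {h \<in> psh_hom I (car \<X>) (car \<Y>).
     \<forall>i. \<forall>t\<in>El (Mnd I \<Sigma> (car \<X>)) i.
       h i (str \<X> i t) = str \<Y> i (Mnd_map I \<Sigma> (car \<X>) h i t)}"

definition alg_tr ::
  "('i, 'm, 'o::wellorder) dcat \<Rightarrow> ('i, 'm, 'f, 'x) sig \<Rightarrow> 'o \<Rightarrow> ('i, 'm, 'f, 'x, 'a) alg \<Rightarrow>
   ('i, 'm, 'f, 'x, 'a) alg" where
  "alg_tr I \<Sigma> \<beta> \<X> = (let X\<^sub>\<beta> = psh_tr I \<beta> (car \<X>) in
     \<lparr>car = X\<^sub>\<beta>, str = restr (El (Mnd I (sig_tr I \<beta> \<Sigma>) X\<^sub>\<beta>)) (str \<X>)\<rparr>)"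

text \<open>The comparison functor; \<open>Free\<close> is its restriction along the inclusion of the variable-to-variable
  morphisms, so it has the same values.\<close>

definition K_ob ::
  "('i, 'm, 'o) dcat \<Rightarrow> ('i, 'm, 'f, 'x) sig \<Rightarrow> ('i, 'm, 'f, 'x, 'v) cptd \<Rightarrow>
   ('i, 'm, 'f, 'x, ('i, 'f, 'x, 'v) tm) alg" where
  "K_ob I \<Sigma> C =
     \<lparr>car = Term I \<Sigma> C, str = Term_map I \<Sigma> (Cptd I (Term I \<Sigma> C)) (eps I \<Sigma> C)\<rparr>"

abbreviation "K_map \<equiv> Term_map"

abbreviation "Free_ob \<equiv> K_ob"
abbreviation "Free_map \<equiv> K_map"


subsection \<open>The functor Und\<close>

text \<open>A generator of \<open>Und X\<close> is a pair of a family of terms on such generators and an element of \<open>X\<close>.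
  The family is a partial function on face maps, defined on the proper face maps into its sort.\<close>

datatype ('i, 'm, 'f, 'x, 'a) ugen =
  UGen (ubd: "'m \<rightharpoonup> ('i, 'f, 'x, ('i, 'm, 'f, 'x, 'a) ugen) tm") (uval: 'a)

definition ucptd ::
  "('i \<Rightarrow> ('i, 'm, 'f, 'x, 'a) ugen set) \<Rightarrow>
   ('i, 'm, 'f, 'x, ('i, 'm, 'f, 'x, 'a) ugen) cptd" where
  "ucptd G = \<lparr>Gen = G, glue = (\<lambda>\<delta> w. the (ubd w \<delta>))\<rparr>"

text \<open>The unique algebra morphism from the free algebra on \<open>C\<close> that sends \<open>var (t, x)\<close> to \<open>x\<close>; the values
  on generators of all dimensions are prescribed at once, which includes compatibility with truncation.\<close>

definition ret_on ::
  "('i, 'm, 'o) dcat \<Rightarrow> ('i, 'm, 'f, 'x) sig \<Rightarrow>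
   ('i, 'm, 'f, 'x, ('i, 'm, 'f, 'x, 'a) ugen) cptd \<Rightarrow> ('i, 'm, 'f, 'x, 'a) alg \<Rightarrow>
   'i \<Rightarrow> ('i, 'f, 'x, ('i, 'm, 'f, 'x, 'a) ugen) tm \<Rightarrow> 'a" where
  "ret_on I \<Sigma> C \<X> = (THE h. h \<in> alg_hom I \<Sigma> (Free_ob I \<Sigma> C) \<X> \<and>
     (\<forall>i. \<forall>w\<in>Gen C i. h i (Var i w) = uval w))"

text \<open>The generators of sort \<open>i\<close>, given the generators \<open>G\<close> of all sorts of smaller dimension.  For
  \<open>\<beta>\<close> below the dimension of \<open>i\<close>, \<open>U\<^sub>\<beta>\<close> is the computad \<open>Und\<close> of the truncated algebra.\<close>

definition und_step ::
  "('i, 'm, 'o::wellorder) dcat \<Rightarrow> ('i, 'm, 'f, 'x) sig \<Rightarrow> ('i, 'm, 'f, 'x, 'a) alg \<Rightarrow> 'i \<Rightarrow>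
   ('i \<Rightarrow> ('i, 'm, 'f, 'x, 'a) ugen set) \<Rightarrow> ('i, 'm, 'f, 'x, 'a) ugen set" where
  "und_step I \<Sigma> \<X> i G = {UGen t x |t x.
     x \<in> El (car \<X>) i \<and>
     dom t = {\<delta>. proper I \<delta> \<and> tgt I \<delta> = i} \<and>
     (\<forall>\<delta>. proper I \<delta> \<longrightarrow> tgt I \<delta> = i \<longrightarrow>
        (let j = src I \<delta>; \<beta> = dim I j; \<Sigma>\<^sub>\<beta> = sig_tr I \<beta> \<Sigma>; U\<^sub>\<beta> = cptd_tr I \<beta> (ucptd G) in
         the (t \<delta>) \<in> El (car (Free_ob I \<Sigma>\<^sub>\<beta> U\<^sub>\<beta>)) j \<and>
         (\<forall>\<delta>'\<in>arr I. tgt I \<delta>' = j \<longrightarrow>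
            act (car (Free_ob I \<Sigma>\<^sub>\<beta> U\<^sub>\<beta>)) \<delta>' (the (t \<delta>)) = the (t (cmp I \<delta> \<delta>'))) \<and>
         ret_on I \<Sigma>\<^sub>\<beta> U\<^sub>\<beta> (alg_tr I \<Sigma> \<beta> \<X>) j (the (t \<delta>)) = act (car \<X>) \<delta> x))}"

function und_gen ::
  "('i, 'm, 'o::wellorder) dcat \<Rightarrow> ('i, 'm, 'f, 'x) sig \<Rightarrow> ('i, 'm, 'f, 'x, 'a) alg \<Rightarrow> 'i \<Rightarrow>
   ('i, 'm, 'f, 'x, 'a) ugen set" where
  "und_gen I \<Sigma> \<X> i =
     und_step I \<Sigma> \<X> i (\<lambda>j. if dim I j < dim I i then und_gen I \<Sigma> \<X> j else {})"
  by pat_completeness auto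
termination
  by (relation "inv_image {(\<beta>, \<alpha>). \<beta> < \<alpha>} (\<lambda>(I, \<Sigma>, \<X>, i). dim I i)") (auto simp: wf)

definition Und_ob ::
  "('i, 'm, 'o::wellorder) dcat \<Rightarrow> ('i, 'm, 'f, 'x) sig \<Rightarrow> ('i, 'm, 'f, 'x, 'a) alg \<Rightarrow>
   ('i, 'm, 'f, 'x, ('i, 'm, 'f, 'x, 'a) ugen) cptd" where
  "Und_ob I \<Sigma> \<X> = ucptd (und_gen I \<Sigma> \<X>)"

text \<open>The map \<open>(t, x) \<mapsto> (Cof(h)(t), h(x))\<close> at sort \<open>i\<close>; only the values of \<open>Und h\<close> below the dimension
  of \<open>i\<close> enter.\<close>

function und_fun ::
  "('i, 'm, 'o::wellorder) dcat \<Rightarrow> ('i, 'm, 'f, 'x) sig \<Rightarrow> ('i \<Rightarrow> 'a \<Rightarrow> 'b) \<Rightarrow> 'i \<Rightarrow>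
   ('i, 'm, 'f, 'x, 'a) ugen \<Rightarrow> ('i, 'm, 'f, 'x, 'b) ugen" where
  "und_fun I \<Sigma> h i w =
     UGen (\<lambda>\<delta>. map_option
             (subst \<Sigma> (\<lambda>j w'. if dim I j < dim I i then Var j (und_fun I \<Sigma> h j w') else undefined))
             (ubd w \<delta>))
          (h i (uval w))"
  by pat_completeness auto
termination
  by (relation "inv_image {(\<beta>, \<alpha>). \<beta> < \<alpha>} (\<lambda>(I, \<Sigma>, h, i, w). dim I i)") (auto simp: wf)

declare und_gen.simps [simp del] und_fun.simps [simp del]

definition Und_map ::
  "('i, 'm, 'o::wellorder) dcat \<Rightarrow> ('i, 'm, 'f, 'x) sig \<Rightarrow> ('i, 'm, 'f, 'x, 'a) alg \<Rightarrow> ('i \<Rightarrow> 'a \<Rightarrow> 'b) \<Rightarrow>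
   'i \<Rightarrow> ('i, 'm, 'f, 'x, 'a) ugen \<Rightarrow> ('i, 'f, 'x, ('i, 'm, 'f, 'x, 'b) ugen) tm" where
  "Und_map I \<Sigma> \<X> h = restr (Gen (Und_ob I \<Sigma> \<X>)) (\<lambda>i w. Var i (und_fun I \<Sigma> h i w))"

definition ret ::
  "('i, 'm, 'o::wellorder) dcat \<Rightarrow> ('i, 'm, 'f, 'x) sig \<Rightarrow> ('i, 'm, 'f, 'x, 'a) alg \<Rightarrow>
   'i \<Rightarrow> ('i, 'f, 'x, ('i, 'm, 'f, 'x, 'a) ugen) tm \<Rightarrow> 'a" where
  "ret I \<Sigma> \<X> = ret_on I \<Sigma> (Und_ob I \<Sigma> \<X>) \<X>"

text \<open>The assignment sending \<open>\<sigma> : C \<rightarrow> Und X\<close> to the composite of \<open>Free(\<sigma>)\<close> with \<open>ret : Free (Und X) \<rightarrow> X\<close>.\<close>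

definition und_transpose ::
  "('i, 'm, 'o::wellorder) dcat \<Rightarrow> ('i, 'm, 'f, 'x) sig \<Rightarrow> ('i, 'm, 'f, 'x, 'v) cptd \<Rightarrow>
   ('i, 'm, 'f, 'x, 'a) alg \<Rightarrow> ('i \<Rightarrow> 'v \<Rightarrow> ('i, 'f, 'x, ('i, 'm, 'f, 'x, 'a) ugen) tm) \<Rightarrow>
   'i \<Rightarrow> ('i, 'f, 'x, 'v) tm \<Rightarrow> 'a" where
  "und_transpose I \<Sigma> C \<X> \<sigma> = psh_comp (car (Free_ob I \<Sigma> C)) (ret I \<Sigma> \<X>) (Free_map I \<Sigma> C \<sigma>)"

end

theory Submission
  imports Defs
begin

text \<open>
  An algebra morphism from \<open>Free C\<close> to \<open>X\<close> is the same as a valuation: an assignment of elements of \<open>X\<close>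
  to the generators of \<open>C\<close> that is compatible with the gluing functions, the extension to all terms being
  evaluation in \<open>X\<close>.  A generator of \<open>Und X\<close> over a given boundary is precisely an element of \<open>X\<close> with the
  boundary that evaluation prescribes, so \<open>(t, x) \<mapsto> x\<close> is a valuation whose extension is the counit \<open>ret\<close>.
  A variable-to-variable morphism \<open>C \<rightarrow> Und X\<close> is determined by the elements of \<open>X\<close> it assigns to generators,
  because the boundary of the image of a generator is the image of its boundary, which involves generators
  of smaller dimension only; conversely every valuation lifts by the same recursion on dimension.
  Functoriality of \<open>Und\<close> and naturality then follow from these two uniqueness statements.
\<close>

subsection \<open>Raw terms\<close>

text \<open>The obstacle is a circle in the definition of \<open>Und\<close>. The generators of a
  sort depend on \<open>ret_on\<close> for truncated algebras, and \<open>ret_on\<close> is a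
  definite description: nothing can be said about its value until existence and uniqueness are
  known. Existence in turn presupposes that the generators of smaller dimension form a computad on
  which \<open>uval\<close> respects boundaries. One induction on dimension breaks the circle, and
  afterwards \<open>ret_on\<close> is replaced by \<open>eval\<close>. Evaluation is defined by
  recursion on raw terms instead of on dimension, so that one function serves an algebra and all its
  truncations, up to an agreement lemma, and commutes with substitution without any typing
  condition. What connects it with the monadic notion of algebra is the identification of
  \<open>str\<close> with evaluation at the identity assignment, which is where the multiplication
  law enters evaluation.\<close>

lemma restr_apply [simp]: "x \<in> S i \<Longrightarrow> restr S h i x = h i x"
  by (simp add: restr_def)

lemma restr_restr [simp]: "restr S (restr S h) = restr S h"
  by (simp add: restr_def fun_eq_iff)

lemma restr_cong: "(\<And>i x. x \<in> S i \<Longrightarrow> h i x = k i x) \<Longrightarrow> restr S h = restr S k"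
  by (simp add: restr_def fun_eq_iff)

lemma restr_ext:
  "restr S h = h \<Longrightarrow> restr S k = k \<Longrightarrow> (\<And>i x. x \<in> S i \<Longrightarrow> h i x = k i x) \<Longrightarrow> h = k"
  by (metis restr_cong)

lemma Gen_Cptd [simp]: "Gen (Cptd I X) = El X"
  by (simp add: Cptd_def)

lemma glue_Cptd [simp]: "glue (Cptd I X) \<delta> x = Var (src I \<delta>) (act X \<delta> x)"
  by (simp add: Cptd_def eta_def)

lemma El_Term [simp]: "t \<in> El (Term I \<Sigma> C) i \<longleftrightarrow> is_term I \<Sigma> C i t"
  by (simp add: Term_def)

lemma act_Term [simp]: "act (Term I \<Sigma> C) = bd I \<Sigma> C"
  by (simp add: Term_def)

lemma El_psh_tr [simp]: "El (psh_tr I \<beta> X) i = (if dim I i \<le> \<beta> then El X i else {})"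
  by (simp add: psh_tr_def)

lemma act_psh_tr [simp]: "act (psh_tr I \<beta> X) = act X"
  by (simp add: psh_tr_def)

lemma car_K_ob [simp]: "car (K_ob I \<Sigma> C) = Term I \<Sigma> C"
  by (simp add: K_ob_def)

lemma Cptd_psh_tr: "Cptd I (psh_tr I \<beta> X) = cptd_tr I \<beta> (Cptd I X)"
  by (rule cptd.equality) (auto simp: fun_eq_iff)

text \<open>The gluing terms of \<open>Cptd I X\<close> are variables, so substitution into them is
  plain application of \<open>\<tau>\<close>. With \<open>T\<close> the terms of \<open>D\<close>
  and \<open>X\<close> a presheaf, this says that morphisms out of \<open>Cptd I X\<close> are the
  presheaf maps from \<open>X\<close> to the terms of \<open>D\<close>, which is the adjunction
  between \<open>Cptd\<close> and \<open>Term\<close>.\<close>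

lemma cptd_mor_Cptd:
  "cptd_mor I \<Sigma> T (Cptd I X) D \<tau> \<longleftrightarrow>
     restr (El X) \<tau> = \<tau> \<and> (\<forall>i. \<forall>x\<in>El X i. T i (\<tau> i x)) \<and>
     (\<forall>\<delta>. proper I \<delta> \<longrightarrow> (\<forall>x\<in>El X (tgt I \<delta>).
        bd I \<Sigma> D \<delta> (\<tau> (tgt I \<delta>) x) = \<tau> (src I \<delta>) (act X \<delta> x)))"
  by (simp add: cptd_mor_def)

text \<open>The generated rule buries the induction hypothesis in the predicate argument of
  \<open>cptd_mor\<close>. Here the morphism condition and the hypothesis for the arguments are
  separated.\<close>

lemma is_term_induct [consumes 1, case_names Var App]:
  assumes "is_term I \<Sigma> C i t"
    and "\<And>i v. v \<in> Gen C i \<Longrightarrow> P i (Var i v)"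
    and "\<And>i f \<tau>. f \<in> Sym \<Sigma> i \<Longrightarrow> cptd_mor I \<Sigma> (is_term I \<Sigma> C) (Cptd I (arity \<Sigma> i f)) C \<tau> \<Longrightarrow>
           (\<And>j x. x \<in> El (arity \<Sigma> i f) j \<Longrightarrow> P j (\<tau> j x)) \<Longrightarrow> P i (App i f \<tau>)"
  shows "P i t"
  using assms(1)
proof (induction rule: is_term.induct)
  case (app f i \<tau>)
  show ?case
    by (rule assms(3)) (use app in \<open>auto simp: cptd_mor_Cptd\<close>)
qed (rule assms(2))

lemma is_term_App:
  "is_term I \<Sigma> C k (App i f \<tau>) \<longleftrightarrow> k = i \<and> f \<in> Sym \<Sigma> i \<and>
     cptd_mor I \<Sigma> (is_term I \<Sigma> C) (Cptd I (arity \<Sigma> i f)) C \<tau>"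
  by (auto elim: is_term.cases intro: is_term.app)

lemma is_term_Var: "is_term I \<Sigma> C k (Var i v) \<longleftrightarrow> k = i \<and> v \<in> Gen C i"
  by (auto elim: is_term.cases intro: is_term.var)

text \<open>Only generators of \<open>C\<close> occur in a term of \<open>C\<close>. Taken with a
  truncated computad for \<open>C\<close>, this gives dependence on generators of small dimension
  alone, on which the recursions on dimension rest.\<close>

lemma subst_cong:
  assumes "is_term I \<Sigma> C i t" and "\<And>j v. v \<in> Gen C j \<Longrightarrow> \<sigma> j v = \<sigma>' j v"
  shows "subst \<Sigma> \<sigma> t = subst \<Sigma> \<sigma>' t"
  using assms by (induction rule: is_term_induct) (auto intro: restr_cong)

lemma subst_restr:
  "is_term I \<Sigma> C i t \<Longrightarrow> subst \<Sigma> (restr (Gen C) \<sigma>) t = subst \<Sigma> \<sigma> t"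
  by (rule subst_cong) auto

text \<open>Substitution restricts the argument family of an operation to its arity. A term has
  families that are already restricted, and is therefore fixed; a raw term need not be.\<close>

lemma subst_Var:
  assumes "is_term I \<Sigma> C i t"
  shows "subst \<Sigma> Var t = t"
  using assms
proof (induction rule: is_term_induct)
  case (App i f \<tau>)
  then have "restr (El (arity \<Sigma> i f)) (\<lambda>j x. subst \<Sigma> Var (\<tau> j x)) = restr (El (arity \<Sigma> i f)) \<tau>"
    by (intro restr_cong)
  with App show ?case
    by (simp add: cptd_mor_Cptd)
qed simp

lemma subst_subst: "subst \<Sigma> \<tau> (subst \<Sigma> \<sigma> t) = subst \<Sigma> (\<lambda>i v. subst \<Sigma> \<tau> (\<sigma> i v)) t"
  by (induction t rule: tm_induct) (auto intro: restr_cong)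

lemma El_Mnd [simp]: "t \<in> El (Mnd I \<Sigma> X) i \<longleftrightarrow> is_term I \<Sigma> (Cptd I X) i t"
  by (simp add: Mnd_def)

text \<open>The generators of \<open>Cptd I (Term I \<Sigma> C)\<close> are themselves terms of
  \<open>C\<close>, and the action of the free algebra flattens terms of terms by substituting each
  for itself.\<close>

lemma str_K_ob:
  "is_term I \<Sigma> (Cptd I (Term I \<Sigma> C)) i t \<Longrightarrow> str (K_ob I \<Sigma> C) i t = subst \<Sigma> (\<lambda>i s. s) t"
  unfolding K_ob_def Term_map_def eps_def
  by (simp, intro subst_cong) auto

lemma Mnd_map_eq:
  "is_term I \<Sigma> (Cptd I X) i t \<Longrightarrow> Mnd_map I \<Sigma> X h i t = subst \<Sigma> (\<lambda>i x. Var i (h i x)) t"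
  unfolding Mnd_map_def Term_map_def Cptd_map_def
  by (simp, intro subst_cong) auto

lemma mu_eq:
  "is_term I \<Sigma> (Cptd I (Mnd I \<Sigma> X)) i t \<Longrightarrow> mu I \<Sigma> X i t = subst \<Sigma> (\<lambda>i s. s) t"
  using str_K_ob[where C = "Cptd I X"] by (simp add: mu_def K_ob_def Mnd_def)

subsection \<open>Evaluation of raw terms\<close>

text \<open>An operation of an algebra is available only through \<open>str\<close>, so the evaluated arguments of \<open>f\<close> are
  regarded as generators of \<open>Cptd X\<close>.\<close>

primrec eval ::
  "('i, 'm, 'f, 'x) sig \<Rightarrow> ('i, 'm, 'f, 'x, 'a) alg \<Rightarrow> ('i \<Rightarrow> 'v \<Rightarrow> 'a) \<Rightarrow> ('i, 'f, 'x, 'v) tm \<Rightarrow> 'a"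
  where
  "eval \<Sigma> \<X> e (Var i v) = e i v"
| "eval \<Sigma> \<X> e (App i f \<tau>) =
     str \<X> i (App i f (restr (El (arity \<Sigma> i f)) (\<lambda>j x. Var j (eval \<Sigma> \<X> e (\<tau> j x)))))"

lemma eval_tr [simp]: "eval (sig_tr I \<beta> \<Sigma>) \<X> e t = eval \<Sigma> \<X> e t"
  by (induction t rule: tm_induct) simp_all

lemma eval_cong:
  assumes "is_term I \<Sigma> C i t" and "\<And>j v. v \<in> Gen C j \<Longrightarrow> e j v = e' j v"
  shows "eval \<Sigma> \<X> e t = eval \<Sigma> \<X> e' t"
  using assms
proof (induction rule: is_term_induct)
  case (App i f \<tau>)
  then show ?case
    by (auto intro!: arg_cong[where f = "\<lambda>\<tau>. str \<X> i (App i f \<tau>)"] restr_cong)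
qed simp

lemma eval_subst: "eval \<Sigma> \<X> e (subst \<Sigma> \<sigma> t) = eval \<Sigma> \<X> (\<lambda>i v. eval \<Sigma> \<X> e (\<sigma> i v)) t"
proof (induction t rule: tm_induct)
  case (App i f \<tau>)
  then show ?case
    by (auto intro!: arg_cong[where f = "\<lambda>\<tau>. str \<X> i (App i f \<tau>)"] restr_cong)
qed simp

text \<open>The boundary condition is imposed on generators only and is propagated to all terms by
  \<open>eval_valuation\<close>. Values of \<open>e\<close> off the generators stay arbitrary, as no
  term of \<open>C\<close> refers to them.\<close>

definition valuation ::
  "('i, 'm, 'o) dcat \<Rightarrow> ('i, 'm, 'f, 'x) sig \<Rightarrow> ('i, 'm, 'f, 'x, 'v) cptd \<Rightarrow>
   ('i, 'm, 'f, 'x, 'a) alg \<Rightarrow> ('i \<Rightarrow> 'v \<Rightarrow> 'a) \<Rightarrow> bool" where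
  "valuation I \<Sigma> C \<X> e \<longleftrightarrow> (\<forall>i. \<forall>v\<in>Gen C i. e i v \<in> El (car \<X>) i \<and>
     (\<forall>\<delta>. proper I \<delta> \<longrightarrow> tgt I \<delta> = i \<longrightarrow> act (car \<X>) \<delta> (e i v) = eval \<Sigma> \<X> e (glue C \<delta> v)))"

text \<open>Brings the boundary in \<open>und_fun\<close> into the form used by
  \<open>lift_gen\<close>, where the domain is tested explicitly.\<close>

lemma map_option_dom:
  "dom m = A \<Longrightarrow> map_option F (m x) = (if x \<in> A then Some (F (the (m x))) else None)"
  by (cases "m x") (auto simp: dom_def)

lemma ex_UGen: "(\<exists>t x. w = UGen t x \<and> P t x) \<longleftrightarrow> P (ubd w) (uval w)"
  by (cases w) simp

text \<open>The variable-to-variable morphism \<open>C \<rightarrow> Und X\<close> with transpose \<open>h\<close>, on generators; its boundary is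
  forced by preservation of gluing.\<close>

function lift_gen ::
  "('i, 'm, 'o::wellorder) dcat \<Rightarrow> ('i, 'm, 'f, 'x) sig \<Rightarrow> ('i, 'm, 'f, 'x, 'v) cptd \<Rightarrow>
   ('i \<Rightarrow> ('i, 'f, 'x, 'v) tm \<Rightarrow> 'a) \<Rightarrow> 'i \<Rightarrow> 'v \<Rightarrow> ('i, 'm, 'f, 'x, 'a) ugen" where
  "lift_gen I \<Sigma> C h i v =
     UGen (\<lambda>\<delta>. if proper I \<delta> \<and> tgt I \<delta> = i
             then Some (subst \<Sigma> (\<lambda>j v'. if dim I j < dim I i then Var j (lift_gen I \<Sigma> C h j v') else undefined)
                         (glue C \<delta> v))
             else None)
          (h i (Var i v))"
  by pat_completeness auto
termination
  by (relation "inv_image {(\<beta>, \<alpha>). \<beta> < \<alpha>} (\<lambda>(I, \<Sigma>, C, h, i, v). dim I i)") (auto simp: wf)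

declare lift_gen.simps [simp del]

subsection \<open>Direct categories and boundaries of terms\<close>

locale sorted_signature =
  fixes I :: "('i, 'm, 'o::wellorder) dcat" and \<alpha> :: 'o and \<Sigma> :: "('i, 'm, 'f, 'x) sig"
  assumes direct: "direct_category I" and signature: "is_signature I \<alpha> \<Sigma>"
begin

lemma idm_props: "i \<in> ob I \<Longrightarrow> idm I i \<in> arr I \<and> src I (idm I i) = i \<and> tgt I (idm I i) = i"
  using direct by (auto simp: direct_category_def)

lemma cmp_props:
  assumes "\<delta> \<in> arr I" "\<delta>' \<in> arr I" "tgt I \<delta>' = src I \<delta>"
  shows "cmp I \<delta> \<delta>' \<in> arr I" "src I (cmp I \<delta> \<delta>') = src I \<delta>'" "tgt I (cmp I \<delta> \<delta>') = tgt I \<delta>"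
  using direct assms by (auto simp: direct_category_def)

lemma cmp_idm:
  "\<delta> \<in> arr I \<Longrightarrow> cmp I \<delta> (idm I (src I \<delta>)) = \<delta>" "\<delta> \<in> arr I \<Longrightarrow> cmp I (idm I (tgt I \<delta>)) \<delta> = \<delta>"
  using direct by (auto simp: direct_category_def)

lemma proper_arr: "proper I \<delta> \<Longrightarrow> \<delta> \<in> arr I"
  by (simp add: proper_def)

lemma proper_dim: "proper I \<delta> \<Longrightarrow> dim I (src I \<delta>) < dim I (tgt I \<delta>)"
  using direct by (auto simp: direct_category_def)

lemma arr_cases:
  assumes "\<delta> \<in> arr I"
  obtains "proper I \<delta>" | "src I \<delta> \<in> ob I" "tgt I \<delta> = src I \<delta>" "\<delta> = idm I (src I \<delta>)"
  using assms idm_props by (force simp: proper_def)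

lemma arr_dim: "\<delta> \<in> arr I \<Longrightarrow> dim I (src I \<delta>) \<le> dim I (tgt I \<delta>)"
  by (erule arr_cases) (auto dest: proper_dim)

text \<open>Identities preserve dimension, whereas this composite lowers it strictly: \<delta>
  lowers it and \<delta>' does not raise it.\<close>

lemma proper_cmp:
  assumes "proper I \<delta>" "\<delta>' \<in> arr I" "tgt I \<delta>' = src I \<delta>"
  shows "proper I (cmp I \<delta> \<delta>')"
proof -
  have "dim I (src I (cmp I \<delta> \<delta>')) < dim I (tgt I (cmp I \<delta> \<delta>'))"
    using assms proper_dim[of \<delta>] arr_dim[of \<delta>'] by (simp add: cmp_props proper_arr)
  then show ?thesis
    using cmp_props(1)[of \<delta> \<delta>'] assms idm_props by (auto simp: proper_def)
qed

lemma bd_idm: "i \<in> ob I \<Longrightarrow> bd I \<Sigma> C (idm I i) t = t"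
  by (simp add: bd_def)

lemma bd_Var: "proper I \<delta> \<Longrightarrow> bd I \<Sigma> C \<delta> (Var i v) = glue C \<delta> v"
  by (simp add: bd_def proper_def)

lemma bd_App: "proper I \<delta> \<Longrightarrow> bd I \<Sigma> C \<delta> (App i f \<tau>) = subst \<Sigma> \<tau> (bdry \<Sigma> f \<delta>)"
  by (simp add: bd_def proper_def)

lemma Sym_ob: "f \<in> Sym \<Sigma> i \<Longrightarrow> i \<in> ob I \<and> dim I i \<le> \<alpha>"
  using signature by (auto simp: is_signature_def)

lemma arity_presheaf: "f \<in> Sym \<Sigma> i \<Longrightarrow> presheaf I (dim I i) (arity \<Sigma> i f)"
  using signature Sym_ob[of f i] by (auto simp: is_signature_def sig_at_def)

lemma arity_act:
  "f \<in> Sym \<Sigma> i \<Longrightarrow> proper I \<delta> \<Longrightarrow> x \<in> El (arity \<Sigma> i f) (tgt I \<delta>) \<Longrightarrow>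
   act (arity \<Sigma> i f) \<delta> x \<in> El (arity \<Sigma> i f) (src I \<delta>)"
  using arity_presheaf[of f i] by (auto simp: presheaf_def proper_arr)

lemma bdry_term:
  assumes "f \<in> Sym \<Sigma> i" "proper I \<delta>" "tgt I \<delta> = i"
  shows "is_term I \<Sigma> (Cptd I (arity \<Sigma> i f)) (src I \<delta>) (bdry \<Sigma> f \<delta>)"
proof -
  have "sig_at I \<Sigma> i"
    using signature Sym_ob[OF assms(1)] by (simp add: is_signature_def)
  then show ?thesis
    using assms by (simp add: sig_at_def Let_def Cptd_psh_tr is_term_tr[OF signature])
qed

lemma bd_bdry:
  assumes "f \<in> Sym \<Sigma> i" "proper I \<delta>" "tgt I \<delta> = i" "\<delta>' \<in> arr I" "tgt I \<delta>' = src I \<delta>"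
  shows "bd I \<Sigma> (Cptd I (arity \<Sigma> i f)) \<delta>' (bdry \<Sigma> f \<delta>) = bdry \<Sigma> f (cmp I \<delta> \<delta>')"
proof -
  have "sig_at I \<Sigma> i"
    using signature Sym_ob[OF assms(1)] by (simp add: is_signature_def)
  then show ?thesis
    using assms by (simp add: sig_at_def Let_def Cptd_psh_tr)
qed

text \<open>For a variable this is the gluing condition on \<sigma>. For an operation the boundary
  is a substitution instance of the fixed term \<open>bdry \<Sigma> f \<delta>\<close>, so the claim
  reduces to associativity of substitution and a case distinction suffices. The restriction in the
  composite with \<sigma> is harmless because \<open>bdry \<Sigma> f \<delta>\<close> is a term over
  the arity.\<close>

lemma bd_subst:
  assumes "cptd_mor I \<Sigma> T C D \<sigma>" "is_term I \<Sigma> C i t" "\<delta> \<in> arr I" "tgt I \<delta> = i"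
  shows "bd I \<Sigma> D \<delta> (subst \<Sigma> \<sigma> t) = subst \<Sigma> \<sigma> (bd I \<Sigma> C \<delta> t)"
  using assms(3)
proof (cases rule: arr_cases)
  case 1
  from assms(2) show ?thesis
  proof cases
    case (var v)
    with assms 1 show ?thesis
      by (auto simp: cptd_mor_def bd_Var)
  next
    case (app f \<tau>)
    have "is_term I \<Sigma> (Cptd I (arity \<Sigma> i f)) (src I \<delta>) (bdry \<Sigma> f \<delta>)"
      using app 1 assms(4) by (intro bdry_term)
    from subst_restr[OF this] show ?thesis
      using 1 app by (simp add: bd_App subst_subst)
  qed
next
  case 2
  then show ?thesis
    by (metis bd_idm)
qed

lemma is_term_subst:
  assumes "cptd_mor I \<Sigma> (is_term I \<Sigma> D) C D \<sigma>" "is_term I \<Sigma> C i t"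
  shows "is_term I \<Sigma> D i (subst \<Sigma> \<sigma> t)"
  using assms(2)
proof (induction rule: is_term_induct)
  case (Var i v)
  with assms(1) show ?case
    by (simp add: cptd_mor_def)
next
  case (App i f \<tau>)
  show ?case
    using App arity_act[OF App(1)]
    by (auto simp: is_term_App cptd_mor_Cptd bd_subst[OF assms(1) _ _ refl] proper_arr)
qed

lemma Cptd_map_hom:
  assumes "h \<in> psh_hom I X Y" "presheaf I \<beta> X"
  shows "cptd_mor I \<Sigma> (is_term I \<Sigma> (Cptd I Y)) (Cptd I X) (Cptd I Y) (Cptd_map X h)"
  using assms unfolding cptd_mor_Cptd
  by (auto simp: Cptd_map_def psh_hom_def is_term_Var bd_Var proper_arr presheaf_def)

lemma glue_term_tr:
  assumes "is_computad I \<beta> \<Sigma> C" "v \<in> Gen C i" "proper I \<delta>" "tgt I \<delta> = i"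
  shows "is_term I (sig_tr I (dim I (src I \<delta>)) \<Sigma>) (cptd_tr I (dim I (src I \<delta>)) C) (src I \<delta>) (glue C \<delta> v)"
  using assms by (fastforce simp: is_computad_def cptd_at_def Let_def)

lemma glue_term:
  assumes "is_computad I \<beta> \<Sigma> C" "v \<in> Gen C i" "proper I \<delta>" "tgt I \<delta> = i"
  shows "is_term I \<Sigma> C (src I \<delta>) (glue C \<delta> v)"
  using glue_term_tr[OF assms] by (simp add: is_term_tr[OF signature])

lemma bd_glue:
  assumes "is_computad I \<beta> \<Sigma> C" "v \<in> Gen C i" "proper I \<delta>" "tgt I \<delta> = i"
    "\<delta>' \<in> arr I" "tgt I \<delta>' = src I \<delta>"
  shows "bd I \<Sigma> C \<delta>' (glue C \<delta> v) = glue C (cmp I \<delta> \<delta>') v"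
  using assms by (fastforce simp: is_computad_def cptd_at_def Let_def)

lemma is_term_bd:
  assumes "is_computad I \<beta> \<Sigma> C" "is_term I \<Sigma> C i t" "\<delta> \<in> arr I" "tgt I \<delta> = i"
  shows "is_term I \<Sigma> C (src I \<delta>) (bd I \<Sigma> C \<delta> t)"
  using assms(3)
proof (cases rule: arr_cases)
  case 1
  from assms(2) show ?thesis
  proof cases
    case (var v)
    with assms 1 show ?thesis
      by (simp add: bd_Var glue_term)
  next
    case (app f \<tau>)
    with 1 assms show ?thesis
      by (auto simp: bd_App intro!: is_term_subst[OF app(3)] bdry_term)
  qed
next
  case 2
  then show ?thesis
    using assms by (metis bd_idm)
qed

lemma bd_cmp:
  assumes "is_computad I \<beta> \<Sigma> C" "is_term I \<Sigma> C i t" "\<delta> \<in> arr I" "tgt I \<delta> = i"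
    "\<delta>' \<in> arr I" "tgt I \<delta>' = src I \<delta>"
  shows "bd I \<Sigma> C (cmp I \<delta> \<delta>') t = bd I \<Sigma> C \<delta>' (bd I \<Sigma> C \<delta> t)"
  using assms(3)
proof (cases rule: arr_cases)
  case 1
  then have 2: "proper I (cmp I \<delta> \<delta>')"
    using assms by (intro proper_cmp)
  from assms(2) show ?thesis
  proof cases
    case (var v)
    with assms 1 2 show ?thesis
      by (simp add: bd_Var bd_glue)
  next
    case (app f \<tau>)
    with 1 assms have "is_term I \<Sigma> (Cptd I (arity \<Sigma> i f)) (src I \<delta>) (bdry \<Sigma> f \<delta>)"
      by (intro bdry_term)
    with 1 2 app assms show ?thesis
      by (simp add: bd_App bd_subst[OF app(3)] bd_bdry)
  qed
next
  case 2
  then show ?thesis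
    using assms by (metis bd_idm cmp_idm(2))
qed

lemma is_term_ob:
  assumes "is_computad I \<beta> \<Sigma> C" "is_term I \<Sigma> C i t"
  shows "i \<in> ob I"
  using assms(2) by cases (use assms(1) Sym_ob in \<open>auto simp: is_computad_def\<close>)

subsection \<open>Free algebras\<close>

lemma presheaf_Term:
  assumes "is_computad I \<alpha> \<Sigma> C"
  shows "presheaf I \<alpha> (Term I \<Sigma> C)"
proof -
  have "dim I i \<le> \<alpha>" if "is_term I \<Sigma> C i t" for i t
    using that by cases (use assms Sym_ob in \<open>auto simp: is_computad_def\<close>)
  moreover have "El (Term I \<Sigma> C) i = {t. is_term I \<Sigma> C i t}" for i
    by (simp add: Term_def)
  ultimately show ?thesis
    using is_term_ob[OF assms] is_term_bd[OF assms _ _ refl] bd_cmp[OF assms _ _ refl]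
    by (auto simp: presheaf_def bd_idm)
qed

lemma is_computad_Cptd:
  assumes "presheaf I \<beta> X"
  shows "is_computad I \<beta> \<Sigma> (Cptd I X)"
proof -
  have act: "act X \<delta> x \<in> El X (src I \<delta>)" if "x \<in> El X (tgt I \<delta>)" "proper I \<delta>" for x \<delta>
    using assms that by (auto simp: presheaf_def proper_arr)
  have "bd I \<Sigma> (Cptd I X) \<delta>' (Var (src I \<delta>) (act X \<delta> x)) =
        Var (src I (cmp I \<delta> \<delta>')) (act X (cmp I \<delta> \<delta>') x)"
    if "x \<in> El X (tgt I \<delta>)" "proper I \<delta>" "\<delta>' \<in> arr I" "tgt I \<delta>' = src I \<delta>" for x \<delta> \<delta>'
    using that(3)
  proof (cases rule: arr_cases)
    case 1
    with that assms show ?thesis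
      by (simp add: bd_Var cmp_props proper_arr presheaf_def)
  next
    case 2
    then show ?thesis
      using that by (metis bd_idm cmp_idm(1) proper_arr)
  qed
  with act assms show ?thesis
    by (auto simp: is_computad_def cptd_at_def Let_def is_term_Var presheaf_def)
qed

lemma presheaf_Mnd: "presheaf I \<alpha> X \<Longrightarrow> presheaf I \<alpha> (Mnd I \<Sigma> X)"
  unfolding Mnd_def by (intro presheaf_Term is_computad_Cptd)

lemma Term_map_hom:
  assumes "\<sigma> \<in> comp_hom I \<Sigma> C D" "is_computad I \<beta> \<Sigma> C"
  shows "Term_map I \<Sigma> C \<sigma> \<in> psh_hom I (Term I \<Sigma> C) (Term I \<Sigma> D)"
  using assms is_term_bd[OF assms(2) _ _ refl]
  by (auto simp: Term_map_def psh_hom_def comp_hom_def is_term_subst bd_subst[OF _ _ _ refl])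

lemma eps_hom:
  assumes "is_computad I \<beta> \<Sigma> C"
  shows "eps I \<Sigma> C \<in> comp_hom I \<Sigma> (Cptd I (Term I \<Sigma> C)) C"
  using is_term_bd[OF assms _ _ refl]
  by (auto simp: comp_hom_def cptd_mor_Cptd eps_def proper_arr)

lemma Mnd_map_term:
  assumes "h \<in> psh_hom I X Y" "presheaf I \<beta> X" "is_term I \<Sigma> (Cptd I X) i t"
  shows "is_term I \<Sigma> (Cptd I Y) i (subst \<Sigma> (\<lambda>i x. Var i (h i x)) t)"
proof -
  have "is_term I \<Sigma> (Cptd I Y) i (subst \<Sigma> (Cptd_map X h) t)"
    by (rule is_term_subst[OF Cptd_map_hom]) fact+
  also have "subst \<Sigma> (Cptd_map X h) t = subst \<Sigma> (\<lambda>i x. Var i (h i x)) t"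
    using assms(3) by (rule subst_cong) (simp add: Cptd_map_def)
  finally show ?thesis .
qed

lemma is_term_flatten:
  assumes "is_computad I \<beta> \<Sigma> C" "is_term I \<Sigma> (Cptd I (Term I \<Sigma> C)) i t"
  shows "is_term I \<Sigma> C i (subst \<Sigma> (\<lambda>i s. s) t)"
proof -
  have "is_term I \<Sigma> C i (subst \<Sigma> (eps I \<Sigma> C) t)"
    using eps_hom[OF assms(1)] assms(2) by (intro is_term_subst) (auto simp: comp_hom_def)
  also have "subst \<Sigma> (eps I \<Sigma> C) t = subst \<Sigma> (\<lambda>i s. s) t"
    using assms(2) by (rule subst_cong) (simp add: eps_def)
  finally show ?thesis .
qed

text \<open>Both sides of the multiplication law flatten three layers of terms into one, starting
  from the inside or from the outside; they agree by associativity of substitution.\<close>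

lemma is_algebra_K_ob:
  assumes "is_computad I \<alpha> \<Sigma> C"
  shows "is_algebra I \<alpha> \<Sigma> (K_ob I \<Sigma> C)"
proof -
  have p: "presheaf I \<alpha> (Term I \<Sigma> C)"
    using assms by (rule presheaf_Term)
  have h: "str (K_ob I \<Sigma> C) \<in> psh_hom I (Mnd I \<Sigma> (Term I \<Sigma> C)) (Term I \<Sigma> C)"
    unfolding Mnd_def K_ob_def using eps_hom[OF assms] is_computad_Cptd[OF p]
    by (simp add: Term_map_hom)
  have "str (K_ob I \<Sigma> C) i (subst \<Sigma> (\<lambda>i x. Var i (str (K_ob I \<Sigma> C) i x)) t) =
        str (K_ob I \<Sigma> C) i (subst \<Sigma> (\<lambda>i s. s) t)"
    if t: "is_term I \<Sigma> (Cptd I (Mnd I \<Sigma> (Term I \<Sigma> C))) i t" for i t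
  proof -
    have 1: "is_term I \<Sigma> (Cptd I (Term I \<Sigma> C)) i (subst \<Sigma> (\<lambda>i x. Var i (str (K_ob I \<Sigma> C) i x)) t)"
      using h presheaf_Mnd[OF p] t by (rule Mnd_map_term)
    have 2: "is_term I \<Sigma> (Cptd I (Term I \<Sigma> C)) i (subst \<Sigma> (\<lambda>i s. s) t)"
      using is_computad_Cptd[OF p] t unfolding Mnd_def by (rule is_term_flatten)
    show ?thesis
      using t unfolding str_K_ob[OF 1] str_K_ob[OF 2] subst_subst
      by (rule subst_cong) (simp add: str_K_ob)
  qed
  with p h show ?thesis
    by (simp add: is_algebra_def eta_def Mnd_map_eq mu_eq str_K_ob is_term_Var)
qed

lemma Term_map_alg_hom:
  assumes "\<sigma> \<in> comp_hom I \<Sigma> C D" "is_computad I \<alpha> \<Sigma> C" 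
  shows "Term_map I \<Sigma> C \<sigma> \<in> alg_hom I \<Sigma> (K_ob I \<Sigma> C) (K_ob I \<Sigma> D)"
proof -
  note h = Term_map_hom[OF assms]
  have "Term_map I \<Sigma> C \<sigma> i (str (K_ob I \<Sigma> C) i t) =
        str (K_ob I \<Sigma> D) i (Mnd_map I \<Sigma> (Term I \<Sigma> C) (Term_map I \<Sigma> C \<sigma>) i t)"
    if t: "is_term I \<Sigma> (Cptd I (Term I \<Sigma> C)) i t" for i t
  proof -
    have "str (K_ob I \<Sigma> C) i t \<in> El (Term I \<Sigma> C) i"
      using is_algebra_K_ob[OF assms(2)] t by (simp add: is_algebra_def psh_hom_def)
    then have "Term_map I \<Sigma> C \<sigma> i (str (K_ob I \<Sigma> C) i t) = subst \<Sigma> (\<lambda>i s. subst \<Sigma> \<sigma> s) t"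
      using t by (simp add: Term_map_def str_K_ob subst_subst)
    also have "\<dots> = subst \<Sigma> (\<lambda>i s. Term_map I \<Sigma> C \<sigma> i s) t"
      using t by (rule subst_cong) (simp add: Term_map_def)
    also have "\<dots> = str (K_ob I \<Sigma> D) i (Mnd_map I \<Sigma> (Term I \<Sigma> C) (Term_map I \<Sigma> C \<sigma>) i t)"
      using t Mnd_map_term[OF h presheaf_Term[OF assms(2)] t]
      by (simp add: Mnd_map_eq str_K_ob subst_subst)
    finally show ?thesis .
  qed
  with h show ?thesis
    by (simp add: alg_hom_def)
qed

subsection \<open>Extension of valuations\<close>

lemma alg_presheaf: "is_algebra I \<alpha> \<Sigma> \<X> \<Longrightarrow> presheaf I \<alpha> (car \<X>)"
  by (simp add: is_algebra_def)

text \<open>\<open>eval\<close> applies \<open>str\<close> only to operations whose arguments are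
  variables, whereas \<open>str\<close> accepts arbitrary terms. The multiplication law reduces the
  second use to the first.\<close>

lemma eval_eq_str:
  assumes "is_algebra I \<alpha> \<Sigma> \<X>" "is_term I \<Sigma> (Cptd I (car \<X>)) i t"
  shows "eval \<Sigma> \<X> (\<lambda>i x. x) t = str \<X> i t"
  using assms(2)
proof (induction rule: is_term_induct)
  case (Var i x)
  with assms(1) show ?case
    by (simp add: is_algebra_def eta_def)
next
  case (App i f \<tau>)
  let ?B = "arity \<Sigma> i f"
  \<comment> \<open>The arguments of \<open>f\<close> become generators of a computad whose
    generators are terms. Flattening this term returns \<open>App i f \<tau>\<close>, while mapping
    \<open>str\<close> over it evaluates the arguments, so it is the instance of the multiplication
    law that is needed.\<close>
  let ?t = "App i f (restr (El ?B) (\<lambda>j x. Var j (\<tau> j x)))"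
  have t: "is_term I \<Sigma> (Cptd I (Mnd I \<Sigma> (car \<X>))) i ?t"
    using App arity_act[OF App(1)]
    by (auto simp: is_term_App cptd_mor_Cptd bd_Var is_term_Var Mnd_def)
  have "str \<X> i (Mnd_map I \<Sigma> (Mnd I \<Sigma> (car \<X>)) (str \<X>) i ?t) = str \<X> i (mu I \<Sigma> (car \<X>) i ?t)"
    using assms(1) t by (simp add: is_algebra_def)
  moreover have "mu I \<Sigma> (car \<X>) i ?t = App i f \<tau>"
    using App(2) unfolding mu_eq[OF t] by (auto simp: cptd_mor_Cptd cong: restr_cong)
  moreover have "Mnd_map I \<Sigma> (Mnd I \<Sigma> (car \<X>)) (str \<X>) i ?t =
      App i f (restr (El ?B) (\<lambda>j x. Var j (str \<X> j (\<tau> j x))))"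
    unfolding Mnd_map_eq[OF t] by (auto intro!: restr_cong)
  moreover have "App i f (restr (El ?B) (\<lambda>j x. Var j (str \<X> j (\<tau> j x)))) =
      (App i f (restr (El ?B) (\<lambda>j x. Var j (eval \<Sigma> \<X> (\<lambda>i x. x) (\<tau> j x)))) :: ('i, 'f, 'x, _) tm)"
    using App(3) by (auto intro!: restr_cong)
  ultimately show ?case
    by simp
qed

text \<open>The last two hypotheses make the evaluated arguments a presheaf map from the arity to
  the carrier. \<open>T\<close> is left general so that it can be instantiated both by the terms of
  a computad and by those of a truncation.\<close>

lemma eval_App_term:
  assumes "f \<in> Sym \<Sigma> i" "cptd_mor I \<Sigma> T (Cptd I (arity \<Sigma> i f)) C \<tau>"
    and "\<And>j x. x \<in> El (arity \<Sigma> i f) j \<Longrightarrow> eval \<Sigma> \<X> e (\<tau> j x) \<in> El (car \<X>) j"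
    and "\<And>\<delta> x. proper I \<delta> \<Longrightarrow> x \<in> El (arity \<Sigma> i f) (tgt I \<delta>) \<Longrightarrow>
      act (car \<X>) \<delta> (eval \<Sigma> \<X> e (\<tau> (tgt I \<delta>) x)) = eval \<Sigma> \<X> e (bd I \<Sigma> C \<delta> (\<tau> (tgt I \<delta>) x))"
  shows "is_term I \<Sigma> (Cptd I (car \<X>)) i
    (App i f (restr (El (arity \<Sigma> i f)) (\<lambda>j x. Var j (eval \<Sigma> \<X> e (\<tau> j x)))))"
  using assms arity_act[OF assms(1)]
  by (auto simp: is_term_App cptd_mor_Cptd bd_Var is_term_Var)

text \<open>Membership and boundaries go through one induction: the arguments of an operation must
  already respect boundaries before \<open>str\<close> is applied to a genuine term over the
  carrier.\<close>

lemma eval_valuation: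
  assumes "is_algebra I \<alpha> \<Sigma> \<X>" "valuation I \<Sigma> C \<X> e" "is_term I \<Sigma> C i t"
  shows "eval \<Sigma> \<X> e t \<in> El (car \<X>) i \<and>
    (\<forall>\<delta>. proper I \<delta> \<longrightarrow> tgt I \<delta> = i \<longrightarrow> act (car \<X>) \<delta> (eval \<Sigma> \<X> e t) = eval \<Sigma> \<X> e (bd I \<Sigma> C \<delta> t))"
  using assms(3)
proof (induction rule: is_term_induct)
  case (Var i v)
  with assms(2) show ?case
    by (simp add: valuation_def bd_Var)
next
  case (App i f \<tau>)
  let ?B = "arity \<Sigma> i f"
  let ?\<tau> = "restr (El ?B) (\<lambda>j x. Var j (eval \<Sigma> \<X> e (\<tau> j x)))"
  have t: "is_term I \<Sigma> (Cptd I (car \<X>)) i (App i f ?\<tau>)"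
    by (rule eval_App_term) (use App in auto)
  have str: "str \<X> \<in> psh_hom I (Mnd I \<Sigma> (car \<X>)) (car \<X>)"
    using assms(1) by (simp add: is_algebra_def)
  have "act (car \<X>) \<delta> (eval \<Sigma> \<X> e (App i f \<tau>)) = eval \<Sigma> \<X> e (bd I \<Sigma> C \<delta> (App i f \<tau>))"
    if \<delta>: "proper I \<delta>" "tgt I \<delta> = i" for \<delta>
  proof -
    note b = bdry_term[OF App(1) \<delta>]
    have "is_term I \<Sigma> (Cptd I (car \<X>)) (src I \<delta>) (bd I \<Sigma> (Cptd I (car \<X>)) \<delta> (App i f ?\<tau>))"
      by (rule is_term_bd[OF is_computad_Cptd[OF alg_presheaf[OF assms(1)]] t])
        (use \<delta> in \<open>auto simp: proper_arr\<close>)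
    then have u: "is_term I \<Sigma> (Cptd I (car \<X>)) (src I \<delta>) (subst \<Sigma> ?\<tau> (bdry \<Sigma> f \<delta>))"
      using \<delta> by (simp add: bd_App)
    have "act (car \<X>) \<delta> (eval \<Sigma> \<X> e (App i f \<tau>)) = str \<X> (src I \<delta>) (subst \<Sigma> ?\<tau> (bdry \<Sigma> f \<delta>))"
      using str t \<delta> by (auto simp: psh_hom_def proper_arr Mnd_def bd_App)
    \<comment> \<open>The boundary is an arbitrary term instead of an operation applied to
      variables, so \<open>str\<close> must first be turned into evaluation; then evaluation and
      substitution commute.\<close>
    also have "\<dots> = eval \<Sigma> \<X> (\<lambda>i x. x) (subst \<Sigma> ?\<tau> (bdry \<Sigma> f \<delta>))"
      using eval_eq_str[OF assms(1) u] by simp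
    also have "\<dots> = eval \<Sigma> \<X> (\<lambda>j x. eval \<Sigma> \<X> e (\<tau> j x)) (bdry \<Sigma> f \<delta>)"
      unfolding eval_subst by (rule eval_cong[OF b]) simp
    also have "\<dots> = eval \<Sigma> \<X> e (bd I \<Sigma> C \<delta> (App i f \<tau>))"
      using \<delta> by (simp add: bd_App eval_subst)
    finally show ?thesis .
  qed
  moreover have "eval \<Sigma> \<X> e (App i f \<tau>) \<in> El (car \<X>) i"
    using str t by (simp add: psh_hom_def)
  ultimately show ?case
    by blast
qed

definition extend ::
  "('i, 'm, 'f, 'x, 'v) cptd \<Rightarrow> ('i, 'm, 'f, 'x, 'a) alg \<Rightarrow> ('i \<Rightarrow> 'v \<Rightarrow> 'a) \<Rightarrow> 'i \<Rightarrow> ('i, 'f, 'x, 'v) tm \<Rightarrow> 'a"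
  where "extend C \<X> e = restr (El (Term I \<Sigma> C)) (\<lambda>i. eval \<Sigma> \<X> e)"

lemma extend_apply [simp]: "is_term I \<Sigma> C i t \<Longrightarrow> extend C \<X> e i t = eval \<Sigma> \<X> e t"
  by (simp add: extend_def)

lemma extend_hom:
  assumes "is_algebra I \<alpha> \<Sigma> \<X>" "valuation I \<Sigma> C \<X> e" "is_computad I \<alpha> \<Sigma> C"
  shows "extend C \<X> e \<in> alg_hom I \<Sigma> (K_ob I \<Sigma> C) \<X>"
proof -
  have "act (car \<X>) \<delta> (eval \<Sigma> \<X> e t) = eval \<Sigma> \<X> e (bd I \<Sigma> C \<delta> t)"
    if "is_term I \<Sigma> C (tgt I \<delta>) t" "\<delta> \<in> arr I" for \<delta> t
    using that(2)
  proof (cases rule: arr_cases)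
    case 1
    then show ?thesis
      using eval_valuation[OF assms(1,2) that(1)] by simp
  next
    case 2
    moreover have "\<forall>i\<in>ob I. \<forall>x\<in>El (car \<X>) i. act (car \<X>) (idm I i) x = x"
      using alg_presheaf[OF assms(1)] by (simp add: presheaf_def)
    ultimately show ?thesis
      using eval_valuation[OF assms(1,2) that(1)] by (metis bd_idm)
  qed
  then have h: "extend C \<X> e \<in> psh_hom I (Term I \<Sigma> C) (car \<X>)"
    using eval_valuation[OF assms(1,2)] is_term_bd[OF assms(3) _ _ refl]
    by (simp add: psh_hom_def extend_def)
  have "extend C \<X> e i (str (K_ob I \<Sigma> C) i t) = str \<X> i (Mnd_map I \<Sigma> (Term I \<Sigma> C) (extend C \<X> e) i t)"
    if t: "is_term I \<Sigma> (Cptd I (Term I \<Sigma> C)) i t" for i t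
  proof -
    have "is_term I \<Sigma> C i (str (K_ob I \<Sigma> C) i t)"
      using is_algebra_K_ob[OF assms(3)] t by (simp add: is_algebra_def psh_hom_def)
    then have "extend C \<X> e i (str (K_ob I \<Sigma> C) i t) = eval \<Sigma> \<X> (\<lambda>i s. eval \<Sigma> \<X> e s) t"
      using t by (simp add: str_K_ob eval_subst)
    also have "\<dots> = eval \<Sigma> \<X> (extend C \<X> e) t"
      using t by (rule eval_cong) simp
    also have "\<dots> = str \<X> i (Mnd_map I \<Sigma> (Term I \<Sigma> C) (extend C \<X> e) i t)"
      using eval_eq_str[OF assms(1) Mnd_map_term[OF h presheaf_Term[OF assms(3)] t]] t
      by (simp add: Mnd_map_eq eval_subst)
    finally show ?thesis .
  qed
  with h show ?thesis
    by (simp add: alg_hom_def)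
qed

lemma alg_hom_eq_extend:
  assumes "h \<in> alg_hom I \<Sigma> (K_ob I \<Sigma> C) \<X>"
    and "\<And>i v. v \<in> Gen C i \<Longrightarrow> h i (Var i v) = e i v"
  shows "h = extend C \<X> e"
proof (rule restr_ext)
  show "restr (El (Term I \<Sigma> C)) h = h"
    using assms(1) by (simp add: alg_hom_def psh_hom_def)
  show "restr (El (Term I \<Sigma> C)) (extend C \<X> e) = extend C \<X> e"
    by (simp add: extend_def)
  show "h i t = extend C \<X> e i t" if "t \<in> El (Term I \<Sigma> C) i" for i t
  proof -
    have "is_term I \<Sigma> C i t"
      using that by simp
    then show ?thesis
    proof (induction rule: is_term_induct)
      case (Var i v)
      with assms(2) show ?case
        by (simp add: is_term_Var)
    next
      case (App i f \<tau>)
      let ?B = "arity \<Sigma> i f"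
      \<comment> \<open>\<open>App i f \<tau>\<close> is the value of the action of the free algebra
        on this term, whose arguments are variables naming the terms in \<open>\<tau>\<close>. An
        algebra morphism therefore passes through \<open>f\<close> to the arguments.\<close>
      let ?t = "App i f (restr (El ?B) (\<lambda>j x. Var j (\<tau> j x)))"
      have t: "is_term I \<Sigma> (Cptd I (Term I \<Sigma> C)) i ?t"
        using App arity_act[OF App(1)]
        by (auto simp: is_term_App cptd_mor_Cptd bd_Var is_term_Var)
      have \<tau>: "is_term I \<Sigma> C j (\<tau> j x)" if "x \<in> El ?B j" for j x
        using App(2) that by (simp add: cptd_mor_Cptd)
      have "App i f \<tau> = str (K_ob I \<Sigma> C) i ?t"
        using App(2) unfolding str_K_ob[OF t] by (auto simp: cptd_mor_Cptd cong: restr_cong)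
      also have "h i \<dots> = str \<X> i (Mnd_map I \<Sigma> (Term I \<Sigma> C) h i ?t)"
        using assms(1) t by (simp add: alg_hom_def)
      also have "Mnd_map I \<Sigma> (Term I \<Sigma> C) h i ?t =
          App i f (restr (El ?B) (\<lambda>j x. Var j (eval \<Sigma> \<X> e (\<tau> j x))))"
        unfolding Mnd_map_eq[OF t] using App(3) \<tau> by (auto intro!: restr_cong)
      finally show ?case
        using App(1,2) by (simp add: is_term_App)
    qed
  qed
qed

text \<open>An algebra morphism equals the extension of its own values on variables, so its value on
  a gluing term is an evaluation. The boundary condition is then its naturality at
  variables.\<close>

lemma valuation_alg_hom:
  assumes "h \<in> alg_hom I \<Sigma> (K_ob I \<Sigma> C) \<X>" "is_computad I \<beta> \<Sigma> C"
  shows "valuation I \<Sigma> C \<X> (\<lambda>i v. h i (Var i v))"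
proof -
  have "h = extend C \<X> (\<lambda>i v. h i (Var i v))"
    using assms(1) by (rule alg_hom_eq_extend) simp
  then have h: "h i t = eval \<Sigma> \<X> (\<lambda>i v. h i (Var i v)) t" if "is_term I \<Sigma> C i t" for i t
    using that by (metis extend_apply)
  have "act (car \<X>) \<delta> (h (tgt I \<delta>) (Var (tgt I \<delta>) v)) =
      eval \<Sigma> \<X> (\<lambda>i v. h i (Var i v)) (glue C \<delta> v)"
    if "proper I \<delta>" "v \<in> Gen C (tgt I \<delta>)" for \<delta> v
  proof -
    have "act (car \<X>) \<delta> (h (tgt I \<delta>) (Var (tgt I \<delta>) v)) = h (src I \<delta>) (glue C \<delta> v)"
      using assms(1) that by (auto simp: alg_hom_def psh_hom_def proper_arr is_term_Var bd_Var)
    also have "\<dots> = eval \<Sigma> \<X> (\<lambda>i v. h i (Var i v)) (glue C \<delta> v)"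
      using h[OF glue_term[OF assms(2) that(2,1) refl]] .
    finally show ?thesis .
  qed
  moreover have "h i (Var i v) \<in> El (car \<X>) i" if "v \<in> Gen C i" for i v
    using assms(1) that by (simp add: alg_hom_def psh_hom_def is_term_Var)
  ultimately show ?thesis
    by (auto simp: valuation_def)
qed

lemma alg_hom_comp:
  assumes "h \<in> alg_hom I \<Sigma> \<X> \<Y>" "k \<in> alg_hom I \<Sigma> \<Y> \<Z>" "is_algebra I \<alpha> \<Sigma> \<X>"
  shows "psh_comp (car \<X>) k h \<in> alg_hom I \<Sigma> \<X> \<Z>"
proof -
  have h: "h \<in> psh_hom I (car \<X>) (car \<Y>)" and k: "k \<in> psh_hom I (car \<Y>) (car \<Z>)"
    using assms by (auto simp: alg_hom_def)
  have kh: "psh_comp (car \<X>) k h \<in> psh_hom I (car \<X>) (car \<Z>)"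
    using h k alg_presheaf[OF assms(3)] by (simp add: psh_comp_def psh_hom_def presheaf_def)
  have "psh_comp (car \<X>) k h i (str \<X> i t) = str \<Z> i (Mnd_map I \<Sigma> (car \<X>) (psh_comp (car \<X>) k h) i t)"
    if t: "is_term I \<Sigma> (Cptd I (car \<X>)) i t" for i t
  proof -
    note t' = Mnd_map_term[OF h alg_presheaf[OF assms(3)] t]
    have "str \<X> i t \<in> El (car \<X>) i"
      using assms(3) t by (simp add: is_algebra_def psh_hom_def)
    then have "psh_comp (car \<X>) k h i (str \<X> i t) =
        str \<Z> i (subst \<Sigma> (\<lambda>i x. Var i (k i (h i x))) t)"
      using assms(1,2) t t'
      by (simp add: psh_comp_def alg_hom_def Mnd_map_eq subst_subst)
    also have "subst \<Sigma> (\<lambda>i x. Var i (k i (h i x))) t =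
        subst \<Sigma> (\<lambda>i x. Var i (psh_comp (car \<X>) k h i x)) t"
      using t by (rule subst_cong) (simp add: psh_comp_def)
    finally show ?thesis
      using t by (simp add: Mnd_map_eq)
  qed
  with kh show ?thesis
    by (simp add: alg_hom_def)
qed

subsection \<open>Truncation\<close>

text \<open>Makes everything shown for \<Sigma> available for its truncations, by interpreting the
  locale again in smaller dimension.\<close>

lemma signature_tr: "sorted_signature I \<beta> (sig_tr I \<beta> \<Sigma>)"
proof
  have "sig_at I (sig_tr I \<beta> \<Sigma>) i" if "i \<in> ob I" for i
  proof (cases "dim I i \<le> \<beta>")
    case True
    then show ?thesis
      using signature that by (simp add: is_signature_def sig_at_tr[OF direct])
  qed (simp add: sig_at_def)
  then show "is_signature I \<beta> (sig_tr I \<beta> \<Sigma>)"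
    using signature by (auto simp: is_signature_def)
qed (rule direct)

text \<open>The hypotheses concern sorts of dimension at most \<beta> only, so the lemma applies
  inside an induction on dimension, when nothing is known above \<beta>.\<close>

lemma is_computad_tr:
  assumes "\<And>i. dim I i \<le> \<beta> \<Longrightarrow> Gen C i \<noteq> {} \<Longrightarrow> i \<in> ob I"
    and "\<And>i. i \<in> ob I \<Longrightarrow> dim I i \<le> \<beta> \<Longrightarrow> cptd_at I \<Sigma> C i"
  shows "is_computad I \<beta> (sig_tr I \<beta> \<Sigma>) (cptd_tr I \<beta> C)"
proof -
  have "cptd_at I (sig_tr I \<beta> \<Sigma>) (cptd_tr I \<beta> C) i" if "i \<in> ob I" for i
  proof (cases "dim I i \<le> \<beta>")
    case True
    then show ?thesis
      using assms(2) that by (simp add: cptd_at_tr[OF direct])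
  qed (simp add: cptd_at_def)
  then show ?thesis
    using assms(1) by (auto simp: is_computad_def)
qed

lemma is_term_tr_dim: "is_term I (sig_tr I \<beta> \<Sigma>) (cptd_tr I \<beta> C) i t \<Longrightarrow> dim I i \<le> \<beta>"
  by (erule is_term.cases) (auto split: if_splits)

lemma Term_tr: "Term I (sig_tr I \<beta> \<Sigma>) (cptd_tr I \<beta> C) = psh_tr I \<beta> (Term I \<Sigma> C)"
proof (rule psh.equality)
  show "El (Term I (sig_tr I \<beta> \<Sigma>) (cptd_tr I \<beta> C)) = El (psh_tr I \<beta> (Term I \<Sigma> C))"
    by (auto simp: fun_eq_iff Term_def is_term_tr[OF signature] dest: is_term_tr_dim)
qed auto

lemma Mnd_tr: "Mnd I (sig_tr I \<beta> \<Sigma>) (psh_tr I \<beta> X) = psh_tr I \<beta> (Mnd I \<Sigma> X)"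
  by (simp add: Mnd_def Cptd_psh_tr Term_tr)

lemma presheaf_tr: "presheaf I \<gamma> X \<Longrightarrow> presheaf I \<beta> (psh_tr I \<beta> X)"
  using arr_dim by (fastforce simp: presheaf_def)

lemma car_alg_tr [simp]: "car (alg_tr I \<Sigma> \<beta> \<X>) = psh_tr I \<beta> (car \<X>)"
  by (simp add: alg_tr_def Let_def)

lemma str_alg_tr:
  "str (alg_tr I \<Sigma> \<beta> \<X>) = restr (El (psh_tr I \<beta> (Mnd I \<Sigma> (car \<X>)))) (str \<X>)"
  by (simp add: alg_tr_def Let_def Mnd_tr)

lemma is_algebra_tr:
  assumes "is_algebra I \<alpha> \<Sigma> \<X>"
  shows "is_algebra I \<beta> (sig_tr I \<beta> \<Sigma>) (alg_tr I \<Sigma> \<beta> \<X>)"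
proof -
  let ?X = "car \<X>" and ?\<Sigma> = "sig_tr I \<beta> \<Sigma>"
  have p: "presheaf I \<alpha> ?X" and str: "str \<X> \<in> psh_hom I (Mnd I \<Sigma> ?X) ?X"
    using assms by (auto simp: is_algebra_def)
  have "act (Mnd I \<Sigma> ?X) \<delta> t \<in> El (Mnd I \<Sigma> ?X) (src I \<delta>)"
    if "\<delta> \<in> arr I" "t \<in> El (Mnd I \<Sigma> ?X) (tgt I \<delta>)" for \<delta> t
    using presheaf_Mnd[OF p] that by (simp add: presheaf_def)
  moreover have "dim I (src I \<delta>) \<le> \<beta>" if "\<delta> \<in> arr I" "dim I (tgt I \<delta>) \<le> \<beta>" for \<delta>
    using arr_dim that by (meson order_trans)
  ultimately have "str (alg_tr I \<Sigma> \<beta> \<X>) \<in> psh_hom I (Mnd I ?\<Sigma> (psh_tr I \<beta> ?X)) (psh_tr I \<beta> ?X)"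
    using str by (simp add: str_alg_tr Mnd_tr psh_hom_def)
  moreover have "str (alg_tr I \<Sigma> \<beta> \<X>) i (eta i x) = x" if "x \<in> El (psh_tr I \<beta> ?X) i" for i x
    using assms that
    by (auto simp: str_alg_tr is_algebra_def eta_def is_term_Var split: if_splits)
  moreover have "str (alg_tr I \<Sigma> \<beta> \<X>) i
        (Mnd_map I ?\<Sigma> (psh_tr I \<beta> (Mnd I \<Sigma> ?X)) (str (alg_tr I \<Sigma> \<beta> \<X>)) i t) =
      str (alg_tr I \<Sigma> \<beta> \<X>) i (mu I ?\<Sigma> (psh_tr I \<beta> ?X) i t)"
    if t: "t \<in> El (Mnd I ?\<Sigma> (psh_tr I \<beta> (Mnd I \<Sigma> ?X))) i" for i t
  proof -
    have i: "dim I i \<le> \<beta>" and t': "is_term I \<Sigma> (Cptd I (Mnd I \<Sigma> ?X)) i t"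
      using t unfolding Mnd_tr by (auto split: if_splits)
    have "Mnd_map I ?\<Sigma> (psh_tr I \<beta> (Mnd I \<Sigma> ?X)) (str (alg_tr I \<Sigma> \<beta> \<X>)) i t =
        subst ?\<Sigma> (\<lambda>i x. Var i (str (alg_tr I \<Sigma> \<beta> \<X>) i x)) t"
      using t by (simp add: Mnd_map_eq)
    also have "\<dots> = subst ?\<Sigma> (\<lambda>i x. Var i (str \<X> i x)) t"
      using t unfolding El_Mnd
      by (rule subst_cong) (auto simp: str_alg_tr)
    also have "\<dots> = Mnd_map I \<Sigma> (Mnd I \<Sigma> ?X) (str \<X>) i t"
      using t' by (simp add: Mnd_map_eq)
    finally have 1: "Mnd_map I ?\<Sigma> (psh_tr I \<beta> (Mnd I \<Sigma> ?X)) (str (alg_tr I \<Sigma> \<beta> \<X>)) i t =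
        Mnd_map I \<Sigma> (Mnd I \<Sigma> ?X) (str \<X>) i t" .
    have 2: "mu I ?\<Sigma> (psh_tr I \<beta> ?X) i t = mu I \<Sigma> ?X i t"
    proof -
      have "is_term I ?\<Sigma> (Cptd I (Mnd I ?\<Sigma> (psh_tr I \<beta> ?X))) i t"
        using t by (simp only: El_Mnd[symmetric] Mnd_tr)
      with t' show ?thesis
        by (simp add: mu_eq)
    qed
    have "is_term I \<Sigma> (Cptd I ?X) i (Mnd_map I \<Sigma> (Mnd I \<Sigma> ?X) (str \<X>) i t)"
      using Mnd_map_term[OF str presheaf_Mnd[OF p] t'] t' by (simp add: Mnd_map_eq)
    \<comment> \<open>The truncated action is \<open>undefined\<close> off the terms over the
      carrier. This fact and the next place both sides of the law inside its domain.\<close>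
    moreover have "is_term I \<Sigma> (Cptd I ?X) i (mu I \<Sigma> ?X i t)"
      using is_term_flatten[OF is_computad_Cptd[OF p]] t' unfolding mu_eq[OF t']
      by (simp add: Mnd_def)
    ultimately show ?thesis
      using assms t' i unfolding 1 2 by (simp add: str_alg_tr is_algebra_def)
  qed
  ultimately show ?thesis
    using presheaf_tr[OF p] by (simp add: is_algebra_def Mnd_tr)
qed

text \<open>The two actions agree only on genuine terms, so at each operation the evaluated
  arguments must be shown to form a term over the carrier. The valuation hypothesis provides
  this.\<close>

lemma eval_alg_tr:
  assumes "is_algebra I \<alpha> \<Sigma> \<X>" "valuation I \<Sigma> (cptd_tr I \<beta> C) \<X> e"
    and "is_term I (sig_tr I \<beta> \<Sigma>) (cptd_tr I \<beta> C) i t"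
  shows "eval \<Sigma> (alg_tr I \<Sigma> \<beta> \<X>) e t = eval \<Sigma> \<X> e t"
  using assms(3)
proof (induction rule: is_term_induct)
  case (App i f \<tau>)
  then have f: "f \<in> Sym \<Sigma> i" "dim I i \<le> \<beta>"
    by (auto split: if_splits)
  have \<tau>: "is_term I \<Sigma> (cptd_tr I \<beta> C) j (\<tau> j x)" if "x \<in> El (arity \<Sigma> i f) j" for j x
  proof -
    have "is_term I (sig_tr I \<beta> \<Sigma>) (cptd_tr I \<beta> C) j (\<tau> j x)"
      using App(2) that by (simp add: cptd_mor_Cptd)
    moreover from this have "dim I j \<le> \<beta>"
      by (rule is_term_tr_dim)
    ultimately show ?thesis
      \<comment> \<open>Only the truncation of the signature is dropped: \<open>is_term_tr\<close>
        is applied to the truncated computad, for which truncating again changes nothing.\<close>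
      using is_term_tr[OF signature, of j \<beta> "cptd_tr I \<beta> C"] by (simp add: cptd_tr_cptd_tr)
  qed
  have "is_term I \<Sigma> (Cptd I (car \<X>)) i
    (App i f (restr (El (arity \<Sigma> i f)) (\<lambda>j x. Var j (eval \<Sigma> \<X> e (\<tau> j x)))))"
    using f(1)
  proof (rule eval_App_term)
    show "cptd_mor I \<Sigma> (is_term I (sig_tr I \<beta> \<Sigma>) (cptd_tr I \<beta> C)) (Cptd I (arity \<Sigma> i f)) (cptd_tr I \<beta> C) \<tau>"
      using App(2) by (simp add: cptd_mor_Cptd)
  qed (use eval_valuation[OF assms(1,2) \<tau>] in auto)
  moreover have "(App i f (restr (El (arity \<Sigma> i f)) (\<lambda>j x. Var j (eval \<Sigma> (alg_tr I \<Sigma> \<beta> \<X>) e (\<tau> j x))))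
      :: ('i, 'f, 'x, _) tm) =
    App i f (restr (El (arity \<Sigma> i f)) (\<lambda>j x. Var j (eval \<Sigma> \<X> e (\<tau> j x))))"
    using App(3) by (auto intro!: restr_cong)
  ultimately show ?case
    using f(2) by (simp add: str_alg_tr)
qed simp

text \<open>Gives the definite description its meaning: existence comes from extending the
  valuation, uniqueness from \<open>alg_hom_eq_extend\<close>.\<close>

lemma ret_on_eq_extend:
  assumes "is_algebra I \<alpha> \<Sigma> \<X>" "is_computad I \<alpha> \<Sigma> C" "valuation I \<Sigma> C \<X> (\<lambda>i. uval)"
  shows "ret_on I \<Sigma> C \<X> = extend C \<X> (\<lambda>i. uval)"
  unfolding ret_on_def
proof (rule the_equality)
  show "extend C \<X> (\<lambda>i. uval) \<in> alg_hom I \<Sigma> (K_ob I \<Sigma> C) \<X> \<and>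
      (\<forall>i. \<forall>w\<in>Gen C i. extend C \<X> (\<lambda>i. uval) i (Var i w) = uval w)"
    using extend_hom[OF assms(1,3,2)] by (simp add: is_term_Var)
qed (use assms in \<open>auto intro: alg_hom_eq_extend\<close>)

subsection \<open>The computad underlying an algebra\<close>

lemma Gen_Und_ob [simp]: "Gen (Und_ob I \<Sigma> \<X>) = und_gen I \<Sigma> \<X>"
  by (simp add: Und_ob_def ucptd_def)

lemma glue_Und_ob [simp]: "glue (Und_ob I \<Sigma> \<X>) \<delta> w = the (ubd w \<delta>)"
  by (simp add: Und_ob_def ucptd_def)

text \<open>The recursion sees only generators below the dimension of \<open>i\<close>. Truncation
  at the source of a proper face map erases the difference from the full \<open>Und_ob\<close>, so
  the guard disappears.\<close>

lemma und_gen_iff_ret_on: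
  "w \<in> und_gen I \<Sigma> \<X> i \<longleftrightarrow>
     uval w \<in> El (car \<X>) i \<and> dom (ubd w) = {\<delta>. proper I \<delta> \<and> tgt I \<delta> = i} \<and>
     (\<forall>\<delta>. proper I \<delta> \<longrightarrow> tgt I \<delta> = i \<longrightarrow>
        (let j = src I \<delta>; \<beta> = dim I j; \<Sigma>\<^sub>\<beta> = sig_tr I \<beta> \<Sigma>; U\<^sub>\<beta> = cptd_tr I \<beta> (Und_ob I \<Sigma> \<X>) in
         is_term I \<Sigma>\<^sub>\<beta> U\<^sub>\<beta> j (the (ubd w \<delta>)) \<and>
         (\<forall>\<delta>'\<in>arr I. tgt I \<delta>' = j \<longrightarrow>
            bd I \<Sigma> (Und_ob I \<Sigma> \<X>) \<delta>' (the (ubd w \<delta>)) = the (ubd w (cmp I \<delta> \<delta>'))) \<and>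
         ret_on I \<Sigma>\<^sub>\<beta> U\<^sub>\<beta> (alg_tr I \<Sigma> \<beta> \<X>) j (the (ubd w \<delta>)) = act (car \<X>) \<delta> (uval w)))"
proof -
  let ?G = "\<lambda>j. if dim I j < dim I i then und_gen I \<Sigma> \<X> j else {}"
  have G: "cptd_tr I (dim I (src I \<delta>)) (ucptd ?G) = cptd_tr I (dim I (src I \<delta>)) (Und_ob I \<Sigma> \<X>)"
    if "proper I \<delta>" "tgt I \<delta> = i" for \<delta>
    using proper_dim[OF that(1)] that(2)
    by (intro cptd.equality) (auto simp: fun_eq_iff Und_ob_def ucptd_def)
  have "w \<in> und_step I \<Sigma> \<X> i ?G \<longleftrightarrow> uval w \<in> El (car \<X>) i \<and>
     dom (ubd w) = {\<delta>. proper I \<delta> \<and> tgt I \<delta> = i} \<and>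
     (\<forall>\<delta>. proper I \<delta> \<longrightarrow> tgt I \<delta> = i \<longrightarrow>
        (let j = src I \<delta>; \<beta> = dim I j; \<Sigma>\<^sub>\<beta> = sig_tr I \<beta> \<Sigma>; U\<^sub>\<beta> = cptd_tr I \<beta> (ucptd ?G) in
         the (ubd w \<delta>) \<in> El (car (Free_ob I \<Sigma>\<^sub>\<beta> U\<^sub>\<beta>)) j \<and>
         (\<forall>\<delta>'\<in>arr I. tgt I \<delta>' = j \<longrightarrow>
            act (car (Free_ob I \<Sigma>\<^sub>\<beta> U\<^sub>\<beta>)) \<delta>' (the (ubd w \<delta>)) = the (ubd w (cmp I \<delta> \<delta>'))) \<and>
         ret_on I \<Sigma>\<^sub>\<beta> U\<^sub>\<beta> (alg_tr I \<Sigma> \<beta> \<X>) j (the (ubd w \<delta>)) = act (car \<X>) \<delta> (uval w)))"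
    unfolding und_step_def mem_Collect_eq by (rule ex_UGen)
  moreover have "bd I \<Sigma> (ucptd ?G) = bd I \<Sigma> (Und_ob I \<Sigma> \<X>)"
    by (simp add: bd_def fun_eq_iff Und_ob_def ucptd_def split: tm.split)
  ultimately show ?thesis
    using G by (subst und_gen.simps) (simp add: Let_def cong: conj_cong)
qed

lemma und_gen_uval: "w \<in> und_gen I \<Sigma> \<X> i \<Longrightarrow> uval w \<in> El (car \<X>) i"
  by (simp add: und_gen_iff_ret_on)

lemma und_gen_ob:
  assumes "is_algebra I \<alpha> \<Sigma> \<X>" "und_gen I \<Sigma> \<X> i \<noteq> {}"
  shows "i \<in> ob I \<and> dim I i \<le> \<alpha>"
proof -
  have "El (car \<X>) i \<noteq> {}"
    using assms(2) und_gen_uval by blast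
  then show ?thesis
    using alg_presheaf[OF assms(1)] by (simp add: presheaf_def)
qed

lemma ret_on_tr:
  assumes "is_algebra I \<alpha> \<Sigma> \<X>" "valuation I \<Sigma> (cptd_tr I \<beta> C) \<X> (\<lambda>i. uval)"
    and "is_computad I \<beta> (sig_tr I \<beta> \<Sigma>) (cptd_tr I \<beta> C)"
    and "is_term I (sig_tr I \<beta> \<Sigma>) (cptd_tr I \<beta> C) i t"
  shows "ret_on I (sig_tr I \<beta> \<Sigma>) (cptd_tr I \<beta> C) (alg_tr I \<Sigma> \<beta> \<X>) i t = eval \<Sigma> \<X> (\<lambda>i. uval) t"
proof -
  interpret tr: sorted_signature I \<beta> "sig_tr I \<beta> \<Sigma>"
    by (rule signature_tr)
  have "eval \<Sigma> (alg_tr I \<Sigma> \<beta> \<X>) (\<lambda>i. uval) (glue C \<delta> w) = eval \<Sigma> \<X> (\<lambda>i. uval) (glue C \<delta> w)"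
    if "proper I \<delta>" "w \<in> Gen (cptd_tr I \<beta> C) (tgt I \<delta>)" for \<delta> w
    using eval_alg_tr[OF assms(1,2)] tr.glue_term[OF assms(3) that(2,1) refl] by simp
  then have "valuation I (sig_tr I \<beta> \<Sigma>) (cptd_tr I \<beta> C) (alg_tr I \<Sigma> \<beta> \<X>) (\<lambda>i. uval)"
    using assms(2) by (simp add: valuation_def)
  then have "ret_on I (sig_tr I \<beta> \<Sigma>) (cptd_tr I \<beta> C) (alg_tr I \<Sigma> \<beta> \<X>) =
      tr.extend (cptd_tr I \<beta> C) (alg_tr I \<Sigma> \<beta> \<X>) (\<lambda>i. uval)"
    by (rule tr.ret_on_eq_extend[OF is_algebra_tr[OF assms(1)] assms(3)])
  then show ?thesis
    using assms(4) by (simp add: eval_alg_tr[OF assms(1,2)])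
qed

text \<open>The two claims support each other: at \<open>i\<close> the generators are constrained by
  \<open>ret_on\<close>, whose value is known only if the computad below is well formed and
  \<open>uval\<close> is a valuation on it.\<close>

lemma Und_ob_at:
  assumes "is_algebra I \<alpha> \<Sigma> \<X>"
  shows "cptd_at I \<Sigma> (Und_ob I \<Sigma> \<X>) i \<and> (\<forall>w\<in>und_gen I \<Sigma> \<X> i. \<forall>\<delta>. proper I \<delta> \<longrightarrow> tgt I \<delta> = i \<longrightarrow>
    act (car \<X>) \<delta> (uval w) = eval \<Sigma> \<X> (\<lambda>i. uval) (the (ubd w \<delta>)))"
proof (induction "dim I i" arbitrary: i rule: less_induct)
  case less
  let ?U = "Und_ob I \<Sigma> \<X>"
  have "act (car \<X>) \<delta> (uval w) = eval \<Sigma> \<X> (\<lambda>i. uval) (the (ubd w \<delta>))"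
    if w: "w \<in> und_gen I \<Sigma> \<X> i" and \<delta>: "proper I \<delta>" "tgt I \<delta> = i" for w \<delta>
  proof -
    let ?\<beta> = "dim I (src I \<delta>)"
    have IH: "cptd_at I \<Sigma> ?U j" "\<And>w \<delta>'. w \<in> und_gen I \<Sigma> \<X> j \<Longrightarrow> proper I \<delta>' \<Longrightarrow> tgt I \<delta>' = j \<Longrightarrow>
        act (car \<X>) \<delta>' (uval w) = eval \<Sigma> \<X> (\<lambda>i. uval) (the (ubd w \<delta>'))" if "dim I j \<le> ?\<beta>" for j
      using less[of j] that proper_dim[OF \<delta>(1)] \<delta>(2) by auto
    have "is_computad I ?\<beta> (sig_tr I ?\<beta> \<Sigma>) (cptd_tr I ?\<beta> ?U)"
      using IH(1) und_gen_ob[OF assms] by (intro is_computad_tr) auto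
    moreover have "valuation I \<Sigma> (cptd_tr I ?\<beta> ?U) \<X> (\<lambda>i. uval)"
      using IH(2) by (auto simp: valuation_def und_gen_uval split: if_splits)
    moreover have "is_term I (sig_tr I ?\<beta> \<Sigma>) (cptd_tr I ?\<beta> ?U) (src I \<delta>) (the (ubd w \<delta>)) \<and>
        ret_on I (sig_tr I ?\<beta> \<Sigma>) (cptd_tr I ?\<beta> ?U) (alg_tr I \<Sigma> ?\<beta> \<X>) (src I \<delta>) (the (ubd w \<delta>)) =
        act (car \<X>) \<delta> (uval w)"
      using w \<delta> by (simp add: und_gen_iff_ret_on Let_def)
    ultimately show ?thesis
      using ret_on_tr[OF assms] by metis
  qed
  then show ?case
    by (auto simp: cptd_at_def Let_def und_gen_iff_ret_on)
qed

lemma is_computad_Und_ob: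
  assumes "is_algebra I \<alpha> \<Sigma> \<X>"
  shows "is_computad I \<alpha> \<Sigma> (Und_ob I \<Sigma> \<X>)"
  using Und_ob_at[OF assms] und_gen_ob[OF assms] by (simp add: is_computad_def)

lemma valuation_uval:
  assumes "is_algebra I \<alpha> \<Sigma> \<X>"
  shows "valuation I \<Sigma> (Und_ob I \<Sigma> \<X>) \<X> (\<lambda>i. uval)"
  using Und_ob_at[OF assms] by (simp add: valuation_def und_gen_uval)

text \<open>With the computad and the valuation established, \<open>ret_on\<close> on truncations
  becomes evaluation in the full algebra.\<close>

lemma und_gen_iff:
  assumes "is_algebra I \<alpha> \<Sigma> \<X>"
  shows "w \<in> und_gen I \<Sigma> \<X> i \<longleftrightarrow>
     uval w \<in> El (car \<X>) i \<and> dom (ubd w) = {\<delta>. proper I \<delta> \<and> tgt I \<delta> = i} \<and>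
     (\<forall>\<delta>. proper I \<delta> \<longrightarrow> tgt I \<delta> = i \<longrightarrow>
         is_term I (sig_tr I (dim I (src I \<delta>)) \<Sigma>) (cptd_tr I (dim I (src I \<delta>)) (Und_ob I \<Sigma> \<X>))
           (src I \<delta>) (the (ubd w \<delta>)) \<and>
         (\<forall>\<delta>'\<in>arr I. tgt I \<delta>' = src I \<delta> \<longrightarrow>
            bd I \<Sigma> (Und_ob I \<Sigma> \<X>) \<delta>' (the (ubd w \<delta>)) = the (ubd w (cmp I \<delta> \<delta>'))) \<and>
         eval \<Sigma> \<X> (\<lambda>i. uval) (the (ubd w \<delta>)) = act (car \<X>) \<delta> (uval w))"
proof -
  have "is_computad I \<beta> (sig_tr I \<beta> \<Sigma>) (cptd_tr I \<beta> (Und_ob I \<Sigma> \<X>))" for \<beta>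
    using is_computad_Und_ob[OF assms] by (intro is_computad_tr) (auto simp: is_computad_def)
  moreover have "valuation I \<Sigma> (cptd_tr I \<beta> (Und_ob I \<Sigma> \<X>)) \<X> (\<lambda>i. uval)" for \<beta>
    using valuation_uval[OF assms] by (simp add: valuation_def)
  ultimately show ?thesis
    unfolding und_gen_iff_ret_on Let_def by (simp add: ret_on_tr[OF assms] cong: conj_cong)
qed

lemma ret_eq_extend:
  "is_algebra I \<alpha> \<Sigma> \<X> \<Longrightarrow> ret I \<Sigma> \<X> = extend (Und_ob I \<Sigma> \<X>) \<X> (\<lambda>i. uval)"
  unfolding ret_def by (rule ret_on_eq_extend[OF _ is_computad_Und_ob valuation_uval])

lemma ret_Var:
  "is_algebra I \<alpha> \<Sigma> \<X> \<Longrightarrow> w \<in> und_gen I \<Sigma> \<X> i \<Longrightarrow> ret I \<Sigma> \<X> i (Var i w) = uval w"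
  by (simp add: ret_eq_extend is_term_Var)

lemma ret_hom:
  "is_algebra I \<alpha> \<Sigma> \<X> \<Longrightarrow> ret I \<Sigma> \<X> \<in> alg_hom I \<Sigma> (K_ob I \<Sigma> (Und_ob I \<Sigma> \<X>)) \<X>"
  unfolding ret_eq_extend by (rule extend_hom[OF _ valuation_uval is_computad_Und_ob])

subsection \<open>Transposition\<close>

lemma comp_id_hom:
  assumes "is_computad I \<alpha> \<Sigma> C"
  shows "comp_id C \<in> var_hom I \<Sigma> C C"
proof -
  have "subst \<Sigma> (comp_id C) (glue C \<delta> v) = glue C \<delta> v"
    if "proper I \<delta>" "v \<in> Gen C (tgt I \<delta>)" for \<delta> v
    using glue_term[OF assms that(2,1) refl] unfolding comp_id_def
    by (simp add: subst_restr subst_Var)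
  then show ?thesis
    by (auto simp: var_hom_def comp_hom_def cptd_mor_def comp_id_def is_term_Var bd_Var)
qed

lemma var_hom_comp:
  assumes "is_computad I \<alpha> \<Sigma> C" "\<sigma> \<in> var_hom I \<Sigma> C D" "\<tau> \<in> var_hom I \<Sigma> D E"
  shows "comp_comp \<Sigma> C \<tau> \<sigma> \<in> var_hom I \<Sigma> C E"
proof -
  have \<sigma>: "cptd_mor I \<Sigma> (is_term I \<Sigma> D) C D \<sigma>" and \<tau>: "cptd_mor I \<Sigma> (is_term I \<Sigma> E) D E \<tau>"
    using assms(2,3) by (auto simp: var_hom_def comp_hom_def)
  have "bd I \<Sigma> E \<delta> (subst \<Sigma> \<tau> (\<sigma> (tgt I \<delta>) v)) = subst \<Sigma> (comp_comp \<Sigma> C \<tau> \<sigma>) (glue C \<delta> v)"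
    if "proper I \<delta>" "v \<in> Gen C (tgt I \<delta>)" for \<delta> v
  proof -
    have "bd I \<Sigma> E \<delta> (subst \<Sigma> \<tau> (\<sigma> (tgt I \<delta>) v)) = subst \<Sigma> \<tau> (bd I \<Sigma> D \<delta> (\<sigma> (tgt I \<delta>) v))"
      using \<sigma> that by (intro bd_subst[OF \<tau> _ _ refl]) (auto simp: cptd_mor_def proper_arr)
    also have "\<dots> = subst \<Sigma> (\<lambda>i v. subst \<Sigma> \<tau> (\<sigma> i v)) (glue C \<delta> v)"
      using \<sigma> that by (simp add: cptd_mor_def subst_subst)
    also have "\<dots> = subst \<Sigma> (comp_comp \<Sigma> C \<tau> \<sigma>) (glue C \<delta> v)"
      unfolding comp_comp_def by (simp add: subst_restr[OF glue_term[OF assms(1) that(2,1) refl]])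
    finally show ?thesis .
  qed
  moreover have "is_term I \<Sigma> E i (subst \<Sigma> \<tau> (\<sigma> i v))" if "v \<in> Gen C i" for i v
    using \<sigma> that by (intro is_term_subst[OF \<tau>]) (simp add: cptd_mor_def)
  moreover have "\<exists>u\<in>Gen E i. comp_comp \<Sigma> C \<tau> \<sigma> i v = Var i u" if "v \<in> Gen C i" for i v
    using assms(2,3) that by (fastforce simp: var_hom_def comp_comp_def)
  moreover have "restr (Gen C) (comp_comp \<Sigma> C \<tau> \<sigma>) = comp_comp \<Sigma> C \<tau> \<sigma>"
    by (simp add: comp_comp_def)
  moreover have "comp_comp \<Sigma> C \<tau> \<sigma> i v = subst \<Sigma> \<tau> (\<sigma> i v)" if "v \<in> Gen C i" for i v
    using that by (simp add: comp_comp_def)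
  ultimately show ?thesis
    by (auto simp: var_hom_def comp_hom_def cptd_mor_def)
qed

lemma Term_map_id:
  "Term_map I \<Sigma> C (comp_id C) = psh_id (Term I \<Sigma> C)"
  unfolding Term_map_def psh_id_def comp_id_def
  by (rule restr_cong) (simp add: subst_restr subst_Var)

lemma Term_map_comp:
  assumes "\<sigma> \<in> comp_hom I \<Sigma> C D"
  shows "Term_map I \<Sigma> C (comp_comp \<Sigma> C \<tau> \<sigma>) =
    psh_comp (Term I \<Sigma> C) (Term_map I \<Sigma> D \<tau>) (Term_map I \<Sigma> C \<sigma>)"
  unfolding Term_map_def psh_comp_def comp_comp_def
  using assms by (intro restr_cong) (simp add: comp_hom_def subst_restr subst_subst is_term_subst)

lemma alg_hom_ext:
  assumes "h \<in> alg_hom I \<Sigma> (K_ob I \<Sigma> C) \<X>" "k \<in> alg_hom I \<Sigma> (K_ob I \<Sigma> C) \<X>"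
    and "\<And>i v. v \<in> Gen C i \<Longrightarrow> h i (Var i v) = k i (Var i v)"
  shows "h = k"
  using alg_hom_eq_extend[OF assms(1,3)] alg_hom_eq_extend[OF assms(2) refl] by simp

lemma und_transpose_hom:
  assumes "is_computad I \<alpha> \<Sigma> C" "is_algebra I \<alpha> \<Sigma> \<X>" "\<sigma> \<in> var_hom I \<Sigma> C (Und_ob I \<Sigma> \<X>)"
  shows "und_transpose I \<Sigma> C \<X> \<sigma> \<in> alg_hom I \<Sigma> (K_ob I \<Sigma> C) \<X>"
  unfolding und_transpose_def using assms
  by (intro alg_hom_comp[OF Term_map_alg_hom ret_hom is_algebra_K_ob]) (auto simp: var_hom_def)

lemma und_transpose_Var:
  assumes "is_algebra I \<alpha> \<Sigma> \<X>" "v \<in> Gen C i" "\<sigma> i v = Var i w" "w \<in> und_gen I \<Sigma> \<X> i"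
  shows "und_transpose I \<Sigma> C \<X> \<sigma> i (Var i v) = uval w"
  using assms by (simp add: und_transpose_def psh_comp_def Term_map_def is_term_Var ret_Var)

lemma var_hom_Und_ext:
  assumes "is_computad I \<alpha> \<Sigma> C" "is_algebra I \<alpha> \<Sigma> \<X>"
    and \<sigma>: "\<sigma> \<in> var_hom I \<Sigma> C (Und_ob I \<Sigma> \<X>)" and \<tau>: "\<tau> \<in> var_hom I \<Sigma> C (Und_ob I \<Sigma> \<X>)"
    and uval: "\<And>i v w w'. v \<in> Gen C i \<Longrightarrow> w \<in> und_gen I \<Sigma> \<X> i \<Longrightarrow> w' \<in> und_gen I \<Sigma> \<X> i \<Longrightarrow>
      \<sigma> i v = Var i w \<Longrightarrow> \<tau> i v = Var i w' \<Longrightarrow> uval w = uval w'"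
  shows "\<sigma> = \<tau>"
proof (rule restr_ext)
  show "restr (Gen C) \<sigma> = \<sigma>" "restr (Gen C) \<tau> = \<tau>"
    using \<sigma> \<tau> by (auto simp: var_hom_def comp_hom_def cptd_mor_def)
  show "\<sigma> i v = \<tau> i v" if "v \<in> Gen C i" for i v
    using that
  proof (induction "dim I i" arbitrary: i v rule: less_induct)
    case less
    obtain w w' where w: "w \<in> und_gen I \<Sigma> \<X> i" "\<sigma> i v = Var i w"
      and w': "w' \<in> und_gen I \<Sigma> \<X> i" "\<tau> i v = Var i w'"
      using \<sigma> \<tau> less.prems by (fastforce simp: var_hom_def)
    have glue: "the (ubd u \<delta>) = subst \<Sigma> \<rho> (glue C \<delta> v)"
      if "proper I \<delta>" "tgt I \<delta> = i" "\<rho> \<in> var_hom I \<Sigma> C (Und_ob I \<Sigma> \<X>)" "\<rho> i v = Var i u" for \<delta> \<rho> u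
      using that less.prems
      by (auto simp: var_hom_def comp_hom_def cptd_mor_def bd_Var dest!: spec[of _ \<delta>] bspec)
    have "ubd w \<delta> = ubd w' \<delta>" for \<delta>
    proof (cases "proper I \<delta> \<and> tgt I \<delta> = i")
      case True
      then have \<delta>: "proper I \<delta>" "tgt I \<delta> = i"
        by auto
      \<comment> \<open>Truncating the signature does not change substitution, but lets the gluing
        term be read as a term over generators of dimension at most that of the source of \<delta>,
        to which the induction hypothesis applies.\<close>
      have "subst (sig_tr I (dim I (src I \<delta>)) \<Sigma>) \<sigma> (glue C \<delta> v) =
            subst (sig_tr I (dim I (src I \<delta>)) \<Sigma>) \<tau> (glue C \<delta> v)"
        using less.hyps proper_dim[OF \<delta>(1)] \<delta>(2)
        by (intro subst_cong[OF glue_term_tr[OF assms(1) less.prems \<delta>]]) (auto split: if_splits)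
      then have "the (ubd w \<delta>) = the (ubd w' \<delta>)"
        using glue[OF \<delta> \<sigma> w(2)] glue[OF \<delta> \<tau> w'(2)] by simp
      moreover have "\<delta> \<in> dom (ubd w)" "\<delta> \<in> dom (ubd w')"
        using w(1) w'(1) True by (auto simp: und_gen_iff[OF assms(2)])
      ultimately show ?thesis
        by auto
    next
      case False
      then have "\<delta> \<notin> dom (ubd w)" "\<delta> \<notin> dom (ubd w')"
        using w(1) w'(1) by (auto simp: und_gen_iff[OF assms(2)])
      then show ?thesis
        by (simp add: domIff)
    qed
    moreover have "uval w = uval w'"
      using uval[OF less.prems w(1) w'(1) w(2) w'(2)] .
    ultimately have "w = w'"
      by (intro ugen.expand) auto
    with w w' show ?case
      by simp
  qed
qed

text \<open>The function \<open>g\<close> is any solution of the recursion on generators, because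
  there are two instances: \<open>lift_gen\<close> for surjectivity of transposition, and
  \<open>und_fun\<close> for the action of \<open>Und\<close> on morphisms.\<close>

lemma lift_hom:
  assumes C: "is_computad I \<alpha> \<Sigma> C" and \<X>: "is_algebra I \<alpha> \<Sigma> \<X>"
    and h: "h \<in> alg_hom I \<Sigma> (K_ob I \<Sigma> C) \<X>"
    and g: "\<And>i v. v \<in> Gen C i \<Longrightarrow> g i v =
     UGen (\<lambda>\<delta>. if proper I \<delta> \<and> tgt I \<delta> = i
             then Some (subst \<Sigma> (\<lambda>j v'. if dim I j < dim I i then Var j (g j v') else undefined) (glue C \<delta> v))
             else None)
          (h i (Var i v))"
  shows "restr (Gen C) (\<lambda>i v. Var i (g i v)) \<in> var_hom I \<Sigma> C (Und_ob I \<Sigma> \<X>)" (is "?\<sigma> \<in> _")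
    and "und_transpose I \<Sigma> C \<X> (restr (Gen C) (\<lambda>i v. Var i (g i v))) = h"
proof -
  let ?U = "Und_ob I \<Sigma> \<X>"
  let ?g = "\<lambda>i v. Var i (g i v)"
  have uval: "uval (g i v) = h i (Var i v)"
    and dom: "dom (ubd (g i v)) = {\<delta>. proper I \<delta> \<and> tgt I \<delta> = i}" if "v \<in> Gen C i" for i v
    using g[OF that] by (auto split: if_splits)
  have ubd: "the (ubd (g i v) \<delta>) = subst \<Sigma> ?g (glue C \<delta> v)"
    if "v \<in> Gen C i" "proper I \<delta>" "tgt I \<delta> = i" for i v \<delta>
  proof -
    have "the (ubd (g i v) \<delta>) =
        subst \<Sigma> (\<lambda>j v'. if dim I j < dim I i then Var j (g j v') else undefined) (glue C \<delta> v)"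
      using g[OF that(1)] that by simp
    \<comment> \<open>Read over the truncation, the gluing term contains only generators of
      dimension below that of \<open>i\<close>, where the guard of the recursion holds.\<close>
    also have "\<dots> = subst (sig_tr I (dim I (src I \<delta>)) \<Sigma>)
        (\<lambda>j v'. if dim I j < dim I i then Var j (g j v') else undefined) (glue C \<delta> v)"
      by simp
    also have "\<dots> = subst (sig_tr I (dim I (src I \<delta>)) \<Sigma>) ?g (glue C \<delta> v)"
      using proper_dim[OF that(2)] that(3)
      by (intro subst_cong[OF glue_term_tr[OF C that]]) (auto split: if_splits)
    finally show ?thesis
      by simp
  qed
  have g_in: "g i v \<in> und_gen I \<Sigma> \<X> i" if "v \<in> Gen C i" for i v
    using that
  proof (induction "dim I i" arbitrary: i v rule: less_induct)
    case (less i v)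
    have "is_term I (sig_tr I (dim I (src I \<delta>)) \<Sigma>) (cptd_tr I (dim I (src I \<delta>)) ?U) (src I \<delta>) (the (ubd (g i v) \<delta>))"
      and "\<And>\<delta>'. \<delta>' \<in> arr I \<Longrightarrow> tgt I \<delta>' = src I \<delta> \<Longrightarrow>
            bd I \<Sigma> ?U \<delta>' (the (ubd (g i v) \<delta>)) = the (ubd (g i v) (cmp I \<delta> \<delta>'))"
      and "eval \<Sigma> \<X> (\<lambda>i. uval) (the (ubd (g i v) \<delta>)) = act (car \<X>) \<delta> (uval (g i v))"
      if \<delta>: "proper I \<delta>" "tgt I \<delta> = i" for \<delta>
    proof -
      let ?\<beta> = "dim I (src I \<delta>)"
      let ?\<Sigma> = "sig_tr I ?\<beta> \<Sigma>" and ?C = "cptd_tr I ?\<beta> C" and ?U\<^sub>\<beta> = "cptd_tr I ?\<beta> ?U"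
      interpret tr: sorted_signature I ?\<beta> ?\<Sigma>
        by (rule signature_tr)
      have Ctr: "is_computad I ?\<beta> ?\<Sigma> ?C"
        using C by (intro is_computad_tr) (auto simp: is_computad_def)
      note glue = glue_term_tr[OF C less.prems \<delta>]
      have restr: "subst \<Sigma> (restr (Gen ?C) ?g) t = subst \<Sigma> ?g t" if "is_term I ?\<Sigma> ?C k t" for k t
        using subst_restr[OF that, of ?g] by simp
      \<comment> \<open>By the induction hypothesis \<open>g\<close> already takes values in the
        generators of \<open>Und\<close> below the dimension of \<open>i\<close>, so it is a
        morphism of truncated computads. The boundary of \<open>g i v\<close> is the image of that
        of \<open>v\<close> under it.\<close>
      have mor: "cptd_mor I ?\<Sigma> (is_term I ?\<Sigma> ?U\<^sub>\<beta>) ?C ?U\<^sub>\<beta> (restr (Gen ?C) ?g)"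
        unfolding cptd_mor_def
      proof (intro conjI allI impI ballI)
        show "is_term I ?\<Sigma> ?U\<^sub>\<beta> k (restr (Gen ?C) ?g k u)" if "u \<in> Gen ?C k" for k u
          using that less.hyps[of k u] proper_dim[OF \<delta>(1)] \<delta>(2)
          by (auto simp: is_term_Var split: if_splits)
        show "bd I ?\<Sigma> ?U\<^sub>\<beta> \<delta>' (restr (Gen ?C) ?g (tgt I \<delta>') u) = subst ?\<Sigma> (restr (Gen ?C) ?g) (glue ?C \<delta>' u)"
          if "proper I \<delta>'" "u \<in> Gen ?C (tgt I \<delta>')" for \<delta>' u
        proof -
          have "u \<in> Gen C (tgt I \<delta>')"
            using that by (auto split: if_splits)
          then show ?thesis
            using that restr[OF tr.glue_term[OF Ctr that(2,1) refl]] ubd[OF _ that(1) refl]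
            by (simp add: bd_Var)
        qed
      qed simp
      note eq = ubd[OF less.prems \<delta>] restr[OF glue, symmetric]
      show "is_term I ?\<Sigma> ?U\<^sub>\<beta> (src I \<delta>) (the (ubd (g i v) \<delta>))"
        using tr.is_term_subst[OF mor glue] eq by simp
      show "bd I \<Sigma> ?U \<delta>' (the (ubd (g i v) \<delta>)) = the (ubd (g i v) (cmp I \<delta> \<delta>'))"
        if "\<delta>' \<in> arr I" "tgt I \<delta>' = src I \<delta>" for \<delta>'
      proof -
        have "bd I \<Sigma> ?U \<delta>' (the (ubd (g i v) \<delta>)) = subst \<Sigma> (restr (Gen ?C) ?g) (bd I \<Sigma> C \<delta>' (glue C \<delta> v))"
          using tr.bd_subst[OF mor glue that] eq by simp
        also have "\<dots> = subst \<Sigma> ?g (bd I \<Sigma> C \<delta>' (glue C \<delta> v))"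
          using restr[OF tr.is_term_bd[OF Ctr glue that]] by simp
        also have "\<dots> = subst \<Sigma> ?g (glue C (cmp I \<delta> \<delta>') v)"
          using bd_glue[OF C less.prems \<delta> that] by simp
        also have "\<dots> = the (ubd (g i v) (cmp I \<delta> \<delta>'))"
          using ubd[OF less.prems proper_cmp[OF \<delta>(1) that]] cmp_props(3)[OF proper_arr[OF \<delta>(1)] that] \<delta>(2)
          by simp
        finally show ?thesis .
      qed
      \<comment> \<open>Evaluating the prescribed boundary amounts to evaluating the gluing term of
        \<open>v\<close> at the values of \<open>h\<close> on variables; these form a valuation,
        which is the constraint linking a boundary to its element.\<close>
      have "eval \<Sigma> \<X> (\<lambda>i. uval) (the (ubd (g i v) \<delta>)) = eval \<Sigma> \<X> (\<lambda>j v'. uval (g j v')) (glue C \<delta> v)"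
        using ubd[OF less.prems \<delta>] by (simp add: eval_subst)
      also have "\<dots> = eval \<Sigma> \<X> (\<lambda>j v'. h j (Var j v')) (glue C \<delta> v)"
        by (rule eval_cong[OF glue_term[OF C less.prems \<delta>] uval])
      also have "\<dots> = act (car \<X>) \<delta> (uval (g i v))"
        using valuation_alg_hom[OF h C] less.prems \<delta> by (simp add: valuation_def uval)
      finally show "eval \<Sigma> \<X> (\<lambda>i. uval) (the (ubd (g i v) \<delta>)) = act (car \<X>) \<delta> (uval (g i v))" .
    qed
    moreover have "uval (g i v) \<in> El (car \<X>) i"
      using valuation_alg_hom[OF h C] less.prems by (simp add: valuation_def uval)
    ultimately show ?case
      using dom[OF less.prems] by (simp add: und_gen_iff[OF \<X>])
  qed
  have "subst \<Sigma> ?g (glue C \<delta> v) = subst \<Sigma> ?\<sigma> (glue C \<delta> v)"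
    if "proper I \<delta>" "v \<in> Gen C (tgt I \<delta>)" for \<delta> v
    by (simp add: subst_restr[OF glue_term[OF C that(2,1) refl]])
  then show \<sigma>: "?\<sigma> \<in> var_hom I \<Sigma> C ?U"
    using g_in ubd[OF _ _ refl] by (auto simp: var_hom_def comp_hom_def cptd_mor_def is_term_Var bd_Var)
  show "und_transpose I \<Sigma> C \<X> ?\<sigma> = h"
    using und_transpose_hom[OF C \<X> \<sigma>] h
    by (rule alg_hom_ext) (use uval in \<open>simp add: und_transpose_Var[OF \<X> _ _ g_in]\<close>)
qed

lemma und_transpose_bij:
  assumes C: "is_computad I \<alpha> \<Sigma> C" and \<X>: "is_algebra I \<alpha> \<Sigma> \<X>"
  shows "bij_betw (und_transpose I \<Sigma> C \<X>)
    (var_hom I \<Sigma> C (Und_ob I \<Sigma> \<X>)) (alg_hom I \<Sigma> (K_ob I \<Sigma> C) \<X>)"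
  unfolding bij_betw_def
proof (intro conjI subset_antisym)
  show "inj_on (und_transpose I \<Sigma> C \<X>) (var_hom I \<Sigma> C (Und_ob I \<Sigma> \<X>))"
  proof (rule inj_onI)
    fix \<sigma> \<tau>
    assume *: "\<sigma> \<in> var_hom I \<Sigma> C (Und_ob I \<Sigma> \<X>)" "\<tau> \<in> var_hom I \<Sigma> C (Und_ob I \<Sigma> \<X>)"
      "und_transpose I \<Sigma> C \<X> \<sigma> = und_transpose I \<Sigma> C \<X> \<tau>"
    show "\<sigma> = \<tau>"
      using C \<X> *(1,2)
    proof (rule var_hom_Und_ext)
      show "uval w = uval w'" if "v \<in> Gen C i" "w \<in> und_gen I \<Sigma> \<X> i" "w' \<in> und_gen I \<Sigma> \<X> i"
        "\<sigma> i v = Var i w" "\<tau> i v = Var i w'" for i v w w'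
        using und_transpose_Var[where \<sigma> = \<sigma>, OF \<X> that(1,4,2)]
          und_transpose_Var[where \<sigma> = \<tau>, OF \<X> that(1,5,3)] *(3) by simp
    qed
  qed
  show "und_transpose I \<Sigma> C \<X> ` var_hom I \<Sigma> C (Und_ob I \<Sigma> \<X>) \<subseteq> alg_hom I \<Sigma> (K_ob I \<Sigma> C) \<X>"
    using und_transpose_hom[OF C \<X>] by blast
  show "alg_hom I \<Sigma> (K_ob I \<Sigma> C) \<X> \<subseteq> und_transpose I \<Sigma> C \<X> ` var_hom I \<Sigma> C (Und_ob I \<Sigma> \<X>)"
  proof
    show "h \<in> und_transpose I \<Sigma> C \<X> ` var_hom I \<Sigma> C (Und_ob I \<Sigma> \<X>)"
      if "h \<in> alg_hom I \<Sigma> (K_ob I \<Sigma> C) \<X>" for h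
    proof (rule image_eqI)
      note lift = lift_hom[where g = "lift_gen I \<Sigma> C h", OF C \<X> that lift_gen.simps]
      show "h = und_transpose I \<Sigma> C \<X> (restr (Gen C) (\<lambda>i v. Var i (lift_gen I \<Sigma> C h i v)))"
        using lift(2) by (rule sym)
      show "restr (Gen C) (\<lambda>i v. Var i (lift_gen I \<Sigma> C h i v)) \<in> var_hom I \<Sigma> C (Und_ob I \<Sigma> \<X>)"
        by (rule lift(1))
    qed
  qed
qed

section \<open>Functoriality of \<open>Und\<close>\<close>

lemma Und_map_hom:
  assumes \<X>: "is_algebra I \<alpha> \<Sigma> \<X>" and \<Y>: "is_algebra I \<alpha> \<Sigma> \<Y>" and h: "h \<in> alg_hom I \<Sigma> \<X> \<Y>"
  shows "Und_map I \<Sigma> \<X> h \<in> var_hom I \<Sigma> (Und_ob I \<Sigma> \<X>) (Und_ob I \<Sigma> \<Y>)"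
proof -
  let ?U = "Und_ob I \<Sigma> \<X>"
  \<comment> \<open>\<open>Und_map\<close> at \<open>h\<close> is the lift of this morphism, the
    counit followed by \<open>h\<close>. On generators it gives \<open>h\<close> applied to
    \<open>uval\<close>, so \<open>und_fun\<close> solves the recursion of
    \<open>lift_hom\<close>.\<close>
  let ?k = "psh_comp (Term I \<Sigma> ?U) h (ret I \<Sigma> \<X>)"
  have k: "?k \<in> alg_hom I \<Sigma> (K_ob I \<Sigma> ?U) \<Y>"
    using alg_hom_comp[OF ret_hom[OF \<X>] h is_algebra_K_ob[OF is_computad_Und_ob[OF \<X>]]] by simp
  have "und_fun I \<Sigma> h i w =
     UGen (\<lambda>\<delta>. if proper I \<delta> \<and> tgt I \<delta> = i
             then Some (subst \<Sigma> (\<lambda>j v'. if dim I j < dim I i then Var j (und_fun I \<Sigma> h j v') else undefined)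
               (glue ?U \<delta> w))
             else None)
          (?k i (Var i w))" if "w \<in> Gen ?U i" for i w
  proof -
    have dom: "dom (ubd w) = {\<delta>. proper I \<delta> \<and> tgt I \<delta> = i}"
      using that by (simp add: und_gen_iff[OF \<X>])
    have "?k i (Var i w) = h i (uval w)"
      using that by (simp add: psh_comp_def is_term_Var ret_Var[OF \<X>])
    then show ?thesis
      by (subst und_fun.simps) (simp add: map_option_dom[OF dom] cong: if_cong)
  qed
  from lift_hom(1)[OF is_computad_Und_ob[OF \<X>] \<Y> k this] show ?thesis
    by (simp add: Und_map_def)
qed

lemma Und_map_apply: "w \<in> und_gen I \<Sigma> \<X> i \<Longrightarrow> Und_map I \<Sigma> \<X> h i w = Var i (und_fun I \<Sigma> h i w)"
  by (simp add: Und_map_def)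

lemma uval_und_fun: "uval (und_fun I \<Sigma> h i w) = h i (uval w)"
  by (subst und_fun.simps) simp

lemma und_fun_in:
  assumes "is_algebra I \<alpha> \<Sigma> \<X>" "is_algebra I \<alpha> \<Sigma> \<Y>" "h \<in> alg_hom I \<Sigma> \<X> \<Y>"
    "w \<in> und_gen I \<Sigma> \<X> i"
  shows "und_fun I \<Sigma> h i w \<in> und_gen I \<Sigma> \<Y> i"
  using Und_map_hom[OF assms(1-3)] assms(4) by (force simp: var_hom_def Und_map_apply)

lemma psh_id_hom:
  assumes "is_algebra I \<alpha> \<Sigma> \<X>"
  shows "psh_id (car \<X>) \<in> alg_hom I \<Sigma> \<X> \<X>"
proof -
  have "psh_id (car \<X>) i (str \<X> i t) = str \<X> i (Mnd_map I \<Sigma> (car \<X>) (psh_id (car \<X>)) i t)"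
    if t: "is_term I \<Sigma> (Cptd I (car \<X>)) i t" for i t
  proof -
    have "subst \<Sigma> (\<lambda>i x. Var i (psh_id (car \<X>) i x)) t = subst \<Sigma> Var t"
      using t by (rule subst_cong) (simp add: psh_id_def)
    moreover have "str \<X> i t \<in> El (car \<X>) i"
      using assms t by (simp add: is_algebra_def psh_hom_def)
    ultimately show ?thesis
      using t by (simp add: Mnd_map_eq subst_Var psh_id_def)
  qed
  moreover have "psh_id (car \<X>) \<in> psh_hom I (car \<X>) (car \<X>)"
    using alg_presheaf[OF assms] by (simp add: psh_hom_def psh_id_def presheaf_def)
  ultimately show ?thesis
    by (simp add: alg_hom_def)
qed

lemma Und_map_id:
  assumes "is_algebra I \<alpha> \<Sigma> \<X>"
  shows "Und_map I \<Sigma> \<X> (psh_id (car \<X>)) = comp_id (Und_ob I \<Sigma> \<X>)"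
  using is_computad_Und_ob[OF assms] assms Und_map_hom[OF assms assms psh_id_hom[OF assms]]
    comp_id_hom[OF is_computad_Und_ob[OF assms]]
  by (rule var_hom_Und_ext)
    (auto simp: Und_map_apply comp_id_def uval_und_fun psh_id_def und_gen_uval)

lemma Und_map_comp:
  assumes \<X>: "is_algebra I \<alpha> \<Sigma> \<X>" and \<Y>: "is_algebra I \<alpha> \<Sigma> \<Y>" and \<Z>: "is_algebra I \<alpha> \<Sigma> \<Z>"
    and h: "h \<in> alg_hom I \<Sigma> \<X> \<Y>" and k: "k \<in> alg_hom I \<Sigma> \<Y> \<Z>"
  shows "Und_map I \<Sigma> \<X> (psh_comp (car \<X>) k h) =
    comp_comp \<Sigma> (Und_ob I \<Sigma> \<X>) (Und_map I \<Sigma> \<Y> k) (Und_map I \<Sigma> \<X> h)"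
  using is_computad_Und_ob[OF \<X>] \<Z> Und_map_hom[OF \<X> \<Z> alg_hom_comp[OF h k \<X>]]
    var_hom_comp[OF is_computad_Und_ob[OF \<X>] Und_map_hom[OF \<X> \<Y> h] Und_map_hom[OF \<Y> \<Z> k]]
  by (rule var_hom_Und_ext)
    (auto simp: Und_map_apply comp_comp_def uval_und_fun psh_comp_def und_gen_uval und_fun_in[OF \<X> \<Y> h])

section \<open>Naturality of transposition\<close>

lemma und_transpose_natural_cptd:
  assumes C: "is_computad I \<alpha> \<Sigma> C" and D: "is_computad I \<alpha> \<Sigma> D" and \<X>: "is_algebra I \<alpha> \<Sigma> \<X>"
    and \<rho>: "\<rho> \<in> var_hom I \<Sigma> C D" and \<sigma>: "\<sigma> \<in> var_hom I \<Sigma> D (Und_ob I \<Sigma> \<X>)"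
  shows "und_transpose I \<Sigma> C \<X> (comp_comp \<Sigma> C \<sigma> \<rho>) =
    psh_comp (Term I \<Sigma> C) (und_transpose I \<Sigma> D \<X> \<sigma>) (Term_map I \<Sigma> C \<rho>)"
  using und_transpose_hom[OF C \<X> var_hom_comp[OF C \<rho> \<sigma>]]
proof (rule alg_hom_ext)
  have "\<rho> \<in> comp_hom I \<Sigma> C D"
    using \<rho> by (simp add: var_hom_def)
  from alg_hom_comp[OF Term_map_alg_hom[OF this C] und_transpose_hom[OF D \<X> \<sigma>] is_algebra_K_ob[OF C]]
  show "psh_comp (Term I \<Sigma> C) (und_transpose I \<Sigma> D \<X> \<sigma>) (Term_map I \<Sigma> C \<rho>) \<in> alg_hom I \<Sigma> (K_ob I \<Sigma> C) \<X>"
    by simp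
  show "und_transpose I \<Sigma> C \<X> (comp_comp \<Sigma> C \<sigma> \<rho>) i (Var i v) =
      psh_comp (Term I \<Sigma> C) (und_transpose I \<Sigma> D \<X> \<sigma>) (Term_map I \<Sigma> C \<rho>) i (Var i v)"
    if v: "v \<in> Gen C i" for i v
  proof -
    \<comment> \<open>As both morphisms send variables to variables, following \<open>v\<close>
      through them ends at one generator of \<open>Und\<close>, and both sides return its
      \<open>uval\<close>.\<close>
    obtain w where w: "w \<in> Gen D i" "\<rho> i v = Var i w"
      using \<rho> v by (auto simp: var_hom_def)
    obtain u where u: "u \<in> und_gen I \<Sigma> \<X> i" "\<sigma> i w = Var i u"
      using \<sigma> w(1) by (fastforce simp: var_hom_def)
    have "comp_comp \<Sigma> C \<sigma> \<rho> i v = Var i u"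
      using v w u by (simp add: comp_comp_def)
    with u v w show ?thesis
      by (simp add: und_transpose_Var[OF \<X>] psh_comp_def Term_map_def is_term_Var)
  qed
qed

lemma und_transpose_natural_alg:
  assumes C: "is_computad I \<alpha> \<Sigma> C" and \<X>: "is_algebra I \<alpha> \<Sigma> \<X>" and \<Y>: "is_algebra I \<alpha> \<Sigma> \<Y>"
    and \<sigma>: "\<sigma> \<in> var_hom I \<Sigma> C (Und_ob I \<Sigma> \<X>)" and h: "h \<in> alg_hom I \<Sigma> \<X> \<Y>"
  shows "und_transpose I \<Sigma> C \<Y> (comp_comp \<Sigma> C (Und_map I \<Sigma> \<X> h) \<sigma>) =
    psh_comp (Term I \<Sigma> C) h (und_transpose I \<Sigma> C \<X> \<sigma>)"
  using und_transpose_hom[OF C \<Y> var_hom_comp[OF C \<sigma> Und_map_hom[OF \<X> \<Y> h]]]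
proof (rule alg_hom_ext)
  from alg_hom_comp[OF und_transpose_hom[OF C \<X> \<sigma>] h is_algebra_K_ob[OF C]]
  show "psh_comp (Term I \<Sigma> C) h (und_transpose I \<Sigma> C \<X> \<sigma>) \<in> alg_hom I \<Sigma> (K_ob I \<Sigma> C) \<Y>"
    by simp
  show "und_transpose I \<Sigma> C \<Y> (comp_comp \<Sigma> C (Und_map I \<Sigma> \<X> h) \<sigma>) i (Var i v) =
      psh_comp (Term I \<Sigma> C) h (und_transpose I \<Sigma> C \<X> \<sigma>) i (Var i v)"
    if v: "v \<in> Gen C i" for i v
  proof -
    obtain w where w: "w \<in> und_gen I \<Sigma> \<X> i" "\<sigma> i v = Var i w"
      using \<sigma> v by (fastforce simp: var_hom_def)
    have "comp_comp \<Sigma> C (Und_map I \<Sigma> \<X> h) \<sigma> i v = Var i (und_fun I \<Sigma> h i w)"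
      using v w by (simp add: comp_comp_def Und_map_apply)
    with und_fun_in[OF \<X> \<Y> h w(1)] v w show ?thesis
      by (simp add: und_transpose_Var[OF \<X>] und_transpose_Var[OF \<Y>] psh_comp_def is_term_Var uval_und_fun)
  qed
qed

end

theorem proposition20:
  fixes I :: "('i, 'm, 'o::wellorder) dcat"
    and \<alpha> :: 'o
    and \<Sigma> :: "('i, 'm, 'f, 'x) sig"
  assumes "direct_category I"
    and "is_signature I \<alpha> \<Sigma>"
  shows
    "\<comment> \<open>Free is a functor\<close>
     (\<forall>C :: ('i, 'm, 'f, 'x, 'v) cptd. is_computad I \<alpha> \<Sigma> C \<longrightarrow>
        is_algebra I \<alpha> \<Sigma> (Free_ob I \<Sigma> C) \<and>
        Free_map I \<Sigma> C (comp_id C) = psh_id (car (Free_ob I \<Sigma> C))) \<and>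
     (\<forall>(C :: ('i, 'm, 'f, 'x, 'v) cptd) (D :: ('i, 'm, 'f, 'x, 'w) cptd).
        is_computad I \<alpha> \<Sigma> C \<longrightarrow> is_computad I \<alpha> \<Sigma> D \<longrightarrow>
        (\<forall>\<sigma>\<in>var_hom I \<Sigma> C D.
           Free_map I \<Sigma> C \<sigma> \<in> alg_hom I \<Sigma> (Free_ob I \<Sigma> C) (Free_ob I \<Sigma> D))) \<and>
     (\<forall>(C :: ('i, 'm, 'f, 'x, 'v) cptd) (D :: ('i, 'm, 'f, 'x, 'w) cptd)
        (E :: ('i, 'm, 'f, 'x, 'z) cptd).
        is_computad I \<alpha> \<Sigma> C \<longrightarrow> is_computad I \<alpha> \<Sigma> D \<longrightarrow> is_computad I \<alpha> \<Sigma> E \<longrightarrow>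
        (\<forall>\<sigma>\<in>var_hom I \<Sigma> C D. \<forall>\<tau>\<in>var_hom I \<Sigma> D E.
           Free_map I \<Sigma> C (comp_comp \<Sigma> C \<tau> \<sigma>) =
           psh_comp (car (Free_ob I \<Sigma> C)) (Free_map I \<Sigma> D \<tau>) (Free_map I \<Sigma> C \<sigma>))) \<and>
     \<comment> \<open>Und is a functor\<close>
     (\<forall>\<X> :: ('i, 'm, 'f, 'x, 'a) alg. is_algebra I \<alpha> \<Sigma> \<X> \<longrightarrow>
        is_computad I \<alpha> \<Sigma> (Und_ob I \<Sigma> \<X>) \<and>
        Und_map I \<Sigma> \<X> (psh_id (car \<X>)) = comp_id (Und_ob I \<Sigma> \<X>)) \<and>
     (\<forall>(\<X> :: ('i, 'm, 'f, 'x, 'a) alg) (\<Y> :: ('i, 'm, 'f, 'x, 'b) alg).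
        is_algebra I \<alpha> \<Sigma> \<X> \<longrightarrow> is_algebra I \<alpha> \<Sigma> \<Y> \<longrightarrow>
        (\<forall>h\<in>alg_hom I \<Sigma> \<X> \<Y>.
           Und_map I \<Sigma> \<X> h \<in> var_hom I \<Sigma> (Und_ob I \<Sigma> \<X>) (Und_ob I \<Sigma> \<Y>))) \<and>
     (\<forall>(\<X> :: ('i, 'm, 'f, 'x, 'a) alg) (\<Y> :: ('i, 'm, 'f, 'x, 'b) alg)
        (\<Z> :: ('i, 'm, 'f, 'x, 'c) alg).
        is_algebra I \<alpha> \<Sigma> \<X> \<longrightarrow> is_algebra I \<alpha> \<Sigma> \<Y> \<longrightarrow> is_algebra I \<alpha> \<Sigma> \<Z> \<longrightarrow>
        (\<forall>h\<in>alg_hom I \<Sigma> \<X> \<Y>. \<forall>k\<in>alg_hom I \<Sigma> \<Y> \<Z>.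
           Und_map I \<Sigma> \<X> (psh_comp (car \<X>) k h) =
           comp_comp \<Sigma> (Und_ob I \<Sigma> \<X>) (Und_map I \<Sigma> \<Y> k) (Und_map I \<Sigma> \<X> h))) \<and>
     \<comment> \<open>transposition along ret is a bijection of hom-sets, natural in both variables\<close>
     (\<forall>(C :: ('i, 'm, 'f, 'x, 'v) cptd) (\<X> :: ('i, 'm, 'f, 'x, 'a) alg).
        is_computad I \<alpha> \<Sigma> C \<longrightarrow> is_algebra I \<alpha> \<Sigma> \<X> \<longrightarrow>
        bij_betw (und_transpose I \<Sigma> C \<X>)
          (var_hom I \<Sigma> C (Und_ob I \<Sigma> \<X>)) (alg_hom I \<Sigma> (Free_ob I \<Sigma> C) \<X>)) \<and>
     (\<forall>(C :: ('i, 'm, 'f, 'x, 'v) cptd) (D :: ('i, 'm, 'f, 'x, 'w) cptd)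
        (\<X> :: ('i, 'm, 'f, 'x, 'a) alg).
        is_computad I \<alpha> \<Sigma> C \<longrightarrow> is_computad I \<alpha> \<Sigma> D \<longrightarrow> is_algebra I \<alpha> \<Sigma> \<X> \<longrightarrow>
        (\<forall>\<rho>\<in>var_hom I \<Sigma> C D. \<forall>\<sigma>\<in>var_hom I \<Sigma> D (Und_ob I \<Sigma> \<X>).
           und_transpose I \<Sigma> C \<X> (comp_comp \<Sigma> C \<sigma> \<rho>) =
           psh_comp (car (Free_ob I \<Sigma> C)) (und_transpose I \<Sigma> D \<X> \<sigma>) (Free_map I \<Sigma> C \<rho>))) \<and>
     (\<forall>(C :: ('i, 'm, 'f, 'x, 'v) cptd) (\<X> :: ('i, 'm, 'f, 'x, 'a) alg)
        (\<Y> :: ('i, 'm, 'f, 'x, 'b) alg).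
        is_computad I \<alpha> \<Sigma> C \<longrightarrow> is_algebra I \<alpha> \<Sigma> \<X> \<longrightarrow> is_algebra I \<alpha> \<Sigma> \<Y> \<longrightarrow>
        (\<forall>\<sigma>\<in>var_hom I \<Sigma> C (Und_ob I \<Sigma> \<X>). \<forall>h\<in>alg_hom I \<Sigma> \<X> \<Y>.
           und_transpose I \<Sigma> C \<Y> (comp_comp \<Sigma> C (Und_map I \<Sigma> \<X> h) \<sigma>) =
           psh_comp (car (Free_ob I \<Sigma> C)) h (und_transpose I \<Sigma> C \<X> \<sigma>)))"
proof -
  interpret sorted_signature I \<alpha> \<Sigma>
    by (rule sorted_signature.intro) fact+
  \<comment> \<open>Functoriality of \<open>Free\<close> was shown for all morphisms of computads;
    this passes to the variable-to-variable ones.\<close>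
  have [dest]: "\<sigma> \<in> var_hom I \<Sigma> C D \<Longrightarrow> \<sigma> \<in> comp_hom I \<Sigma> C D"
    for C :: "('i, 'm, 'f, 'x, 'v) cptd" and D :: "('i, 'm, 'f, 'x, 'w) cptd" and \<sigma>
    by (simp add: var_hom_def)
  show ?thesis
    unfolding car_K_ob
    by (intro conjI allI impI ballI is_algebra_K_ob Term_map_id Term_map_alg_hom Term_map_comp
        is_computad_Und_ob Und_map_id Und_map_hom Und_map_comp und_transpose_bij
        und_transpose_natural_cptd und_transpose_natural_alg) auto
qed

end
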